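(* Let $E$ and $F$ be Archimedean vector lattices. Let $(f_\alpha)_{\alpha\in A}$ be a net in $E$ and $f\in E$ with $f_\alpha\xrightarrow{uo} f$ in $E$, and let $(g_\beta)_{\beta\in B}$ be a net in $F$ and $g\in F$ with $g_\beta\xrightarrow{uo} g$ in $F$. Then the net $(f_\alpha\otimes g_\beta)_{(\alpha,\beta)\in A\times B}$ satisfies $f_\alpha\otimes g_\beta\xrightarrow{uo} f\otimes g$ in the Fremlin tensor product $E\overline{\otimes}F$.
   Context: Order convergence: a net $(x_\alpha)$ in a vector lattice $E$ converges in order to $x\in E$, written $x_\alpha\xrightarrow{o}x$, if there is a net $(u_\gamma)$ in $E$ (possibly over a different index set) with $u_\gamma\downarrow 0$ (decreasing with infimum $0$) such that for every $\gamma$ there is $\alpha_0$ with $|x_\alpha-x|\le u_\gamma$ for all $\alpha\ge\alpha_0$. Unbounded order convergence: $x_\alpha\xrightarrow{uo}x$ means that for each $u\in E_+$ the net $(|x_\alpha-x|\wedge u)_\alpha$ converges to $0$ in order. Fremlin tensor product: for Archimedean vector lattices $E,F$, the space $E\overline{\otimes}F$ is the (essentially unique) Archimedean vector lattice such that (i) the algebraic tensor product $E\otimes F$ is a vector subspace of $E\overline{\otimes}F$; (ii) the vector sublattice generated by $E\otimes F$ is all of $E\overline{\otimes}F$; (iii) the map $(x,y)\mapsto x\otimes y$ is a lattice bimorphism $E\times F\to E\overline{\otimes}F$, and for each Archimedean vector lattice $G$ and each lattice bimorphism $\Phi:E\times F\to G$ there is a unique lattice homomorphism $T:E\overline{\otimes}F\to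 G$ with $T(x\otimes y)=\Phi(x,y)$ for all $x\in E$, $y\in F$. A lattice bimorphism is a bilinear map $\Phi$ such that $\Phi(x,\cdot)$ and $\Phi(\cdot,y)$ are lattice homomorphisms for all $x\in E_+$, $y\in F_+$. The index set $A\times B$ is directed by the product order: $(\alpha,\beta)\le(\alpha',\beta')$ iff $\alpha\le\alpha'$ and $\beta\le\beta'$. *)

theory Defs
  imports Complex_Main "HOL-Library.Lattice_Algebras" "HOL-Library.Poly_Mapping"
begin

class vector_lattice = ordered_real_vector + lattice_ab_group_add_abs

class archimedean_vector_lattice = vector_lattice +
  assumes archimedean: "(\<And>n::nat. real n *\<^sub>R x \<le> y) \<Longrightarrow> x \<le> 0"

instance real :: archimedean_vector_lattice
proof
  fix x y :: real
  assume le: "real n *\<^sub>R x \<le> y" for n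
  show "x \<le> 0"
  proof (rule ccontr)
    assume "\<not> x \<le> 0"
    then obtain n where "y < real n * x"
      using reals_Archimedean3[of x] by auto
    with le[of n] show False by simp
  qed
qed

definition vector_sublattice :: "'a::vector_lattice set \<Rightarrow> bool" where
  "vector_sublattice S \<longleftrightarrow>
     subspace S \<and> (\<forall>x\<in>S. \<forall>y\<in>S. sup x y \<in> S \<and> inf x y \<in> S)"

definition directed_set :: "'i set \<Rightarrow> ('i \<Rightarrow> 'i \<Rightarrow> bool) \<Rightarrow> bool" where
  "directed_set A le \<longleftrightarrow>
     A \<noteq> {} \<and>
     (\<forall>a\<in>A. le a a) \<and>
     (\<forall>a\<in>A. \<forall>b\<in>A. \<forall>c\<in>A. le a b \<longrightarrow> le b c \<longrightarrow> le a c) \<and>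
     (\<forall>a\<in>A. \<forall>b\<in>A. \<exists>c\<in>A. le a c \<and> le b c)"

definition decreases_to_zero ::
    "'i set \<Rightarrow> ('i \<Rightarrow> 'i \<Rightarrow> bool) \<Rightarrow> ('i \<Rightarrow> 'a::vector_lattice) \<Rightarrow> bool" where
  "decreases_to_zero C le u \<longleftrightarrow>
     (\<forall>c\<in>C. \<forall>d\<in>C. le c d \<longrightarrow> u d \<le> u c) \<and>
     (\<forall>c\<in>C. 0 \<le> u c) \<and>
     (\<forall>z. (\<forall>c\<in>C. z \<le> u c) \<longrightarrow> z \<le> 0)"

text \<open>
  The dominating net is indexed by an arbitrary directed set of elements of the lattice's own
  type. This is no restriction: any net decreasing to zero may be replaced by its range, directed
  by reversed order, with the identity as the net.
\<close>

definition order_converges ::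
    "'i set \<Rightarrow> ('i \<Rightarrow> 'i \<Rightarrow> bool) \<Rightarrow> ('i \<Rightarrow> 'a::vector_lattice) \<Rightarrow> 'a \<Rightarrow> bool" where
  "order_converges A le x l \<longleftrightarrow>
     (\<exists>(C :: 'a set) (leC :: 'a \<Rightarrow> 'a \<Rightarrow> bool) (u :: 'a \<Rightarrow> 'a).
        directed_set C leC \<and> decreases_to_zero C leC u \<and>
        (\<forall>c\<in>C. \<exists>a0\<in>A. \<forall>a\<in>A. le a0 a \<longrightarrow> \<bar>x a - l\<bar> \<le> u c))"

definition uo_converges ::
    "'i set \<Rightarrow> ('i \<Rightarrow> 'i \<Rightarrow> bool) \<Rightarrow> ('i \<Rightarrow> 'a::vector_lattice) \<Rightarrow> 'a \<Rightarrow> bool" where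
  "uo_converges A le x l \<longleftrightarrow>
     (\<forall>u\<ge>0. order_converges A le (\<lambda>a. inf \<bar>x a - l\<bar> u) 0)"

text \<open>
  The universal property of the Fremlin tensor product quantifies over all Archimedean vector
  lattices, which a type class cannot express; the targets of that quantification are
  vector lattices given by explicit structure on a subset of a type.
\<close>

record 'g ordered_space =
  vcarrier :: "'g set"
  vzero :: 'g
  vadd :: "'g \<Rightarrow> 'g \<Rightarrow> 'g"
  vscale :: "real \<Rightarrow> 'g \<Rightarrow> 'g"
  vle :: "'g \<Rightarrow> 'g \<Rightarrow> bool"

definition is_sup_in :: "'g ordered_space \<Rightarrow> 'g \<Rightarrow> 'g \<Rightarrow> 'g \<Rightarrow> bool" where
  "is_sup_in G x y s \<longleftrightarrow>
     s \<in> vcarrier G \<and> vle G x s \<and> vle G y s \<and>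
     (\<forall>z\<in>vcarrier G. vle G x z \<longrightarrow> vle G y z \<longrightarrow> vle G s z)"

definition is_inf_in :: "'g ordered_space \<Rightarrow> 'g \<Rightarrow> 'g \<Rightarrow> 'g \<Rightarrow> bool" where
  "is_inf_in G x y s \<longleftrightarrow>
     s \<in> vcarrier G \<and> vle G s x \<and> vle G s y \<and>
     (\<forall>z\<in>vcarrier G. vle G z x \<longrightarrow> vle G z y \<longrightarrow> vle G z s)"

locale carrier_vector_lattice =
  fixes G :: "'g ordered_space"
  assumes zero_closed: "vzero G \<in> vcarrier G"
    and add_closed: "x \<in> vcarrier G \<Longrightarrow> y \<in> vcarrier G \<Longrightarrow> vadd G x y \<in> vcarrier G"
    and scale_closed: "x \<in> vcarrier G \<Longrightarrow> vscale G c x \<in> vcarrier G"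
    and add_assoc: "x \<in> vcarrier G \<Longrightarrow> y \<in> vcarrier G \<Longrightarrow> z \<in> vcarrier G \<Longrightarrow>
      vadd G (vadd G x y) z = vadd G x (vadd G y z)"
    and add_commute: "x \<in> vcarrier G \<Longrightarrow> y \<in> vcarrier G \<Longrightarrow> vadd G x y = vadd G y x"
    and add_zero: "x \<in> vcarrier G \<Longrightarrow> vadd G (vzero G) x = x"
    and add_inverse: "x \<in> vcarrier G \<Longrightarrow> \<exists>y\<in>vcarrier G. vadd G x y = vzero G"
    and scale_add_right: "x \<in> vcarrier G \<Longrightarrow> y \<in> vcarrier G \<Longrightarrow>
      vscale G c (vadd G x y) = vadd G (vscale G c x) (vscale G c y)"
    and scale_add_left: "x \<in> vcarrier G \<Longrightarrow>
      vscale G (c + d) x = vadd G (vscale G c x) (vscale G d x)"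
    and scale_scale: "x \<in> vcarrier G \<Longrightarrow> vscale G c (vscale G d x) = vscale G (c * d) x"
    and scale_one: "x \<in> vcarrier G \<Longrightarrow> vscale G 1 x = x"
    and le_refl: "x \<in> vcarrier G \<Longrightarrow> vle G x x"
    and le_antisym: "x \<in> vcarrier G \<Longrightarrow> y \<in> vcarrier G \<Longrightarrow> vle G x y \<Longrightarrow> vle G y x \<Longrightarrow> x = y"
    and le_trans: "x \<in> vcarrier G \<Longrightarrow> y \<in> vcarrier G \<Longrightarrow> z \<in> vcarrier G \<Longrightarrow>
      vle G x y \<Longrightarrow> vle G y z \<Longrightarrow> vle G x z"
    and add_mono: "x \<in> vcarrier G \<Longrightarrow> y \<in> vcarrier G \<Longrightarrow> z \<in> vcarrier G \<Longrightarrow>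
      vle G x y \<Longrightarrow> vle G (vadd G x z) (vadd G y z)"
    and scale_mono: "x \<in> vcarrier G \<Longrightarrow> y \<in> vcarrier G \<Longrightarrow> 0 \<le> c \<Longrightarrow>
      vle G x y \<Longrightarrow> vle G (vscale G c x) (vscale G c y)"
    and sup_exists: "x \<in> vcarrier G \<Longrightarrow> y \<in> vcarrier G \<Longrightarrow> \<exists>s. is_sup_in G x y s"
    and inf_exists: "x \<in> vcarrier G \<Longrightarrow> y \<in> vcarrier G \<Longrightarrow> \<exists>s. is_inf_in G x y s"

locale carrier_archimedean_vector_lattice = carrier_vector_lattice +
  assumes archimedean: "x \<in> vcarrier G \<Longrightarrow> y \<in> vcarrier G \<Longrightarrow>
      (\<And>n::nat. vle G (vscale G (real n) x) y) \<Longrightarrow> vle G x (vzero G)"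

definition type_space :: "'a::vector_lattice ordered_space" where
  "type_space = \<lparr>vcarrier = UNIV, vzero = 0, vadd = (+), vscale = (*\<^sub>R), vle = (\<le>)\<rparr>"

lemma type_space_sel [simp]:
  "vcarrier type_space = UNIV" "vzero type_space = 0" "vadd type_space = (+)"
  "vscale type_space = (*\<^sub>R)" "vle type_space = (\<le>)"
  by (simp_all add: type_space_def)

lemma is_sup_in_type_space [simp]: "is_sup_in type_space x y s \<longleftrightarrow> s = sup x y"
  by (auto simp: is_sup_in_def intro: order.antisym)

lemma is_inf_in_type_space [simp]: "is_inf_in type_space x y s \<longleftrightarrow> s = inf x y"
  by (auto simp: is_inf_in_def intro: order.antisym)

lemma carrier_archimedean_vector_lattice_type_space:
  "carrier_archimedean_vector_lattice (type_space :: 'a::archimedean_vector_lattice ordered_space)"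
proof
  show "\<exists>y\<in>vcarrier type_space. vadd type_space x y = vzero type_space" for x :: 'a
    by (auto intro: exI[of _ "- x"])
qed (auto simp: ac_simps scaleR_add_right scaleR_add_left scaleR_left_mono intro: archimedean)

definition linear_into :: "'g ordered_space \<Rightarrow> ('a::real_vector \<Rightarrow> 'g) \<Rightarrow> bool" where
  "linear_into G h \<longleftrightarrow>
     (\<forall>x. h x \<in> vcarrier G) \<and>
     (\<forall>x y. h (x + y) = vadd G (h x) (h y)) \<and>
     (\<forall>c x. h (c *\<^sub>R x) = vscale G c (h x))"

definition lattice_hom_into :: "'g ordered_space \<Rightarrow> ('a::vector_lattice \<Rightarrow> 'g) \<Rightarrow> bool" where
  "lattice_hom_into G h \<longleftrightarrow>
     linear_into G h \<and>
     (\<forall>x y. is_sup_in G (h x) (h y) (h (sup x y))) \<and>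
     (\<forall>x y. is_inf_in G (h x) (h y) (h (inf x y)))"

definition lattice_bimorphism_into ::
    "'g ordered_space \<Rightarrow> ('a::vector_lattice \<Rightarrow> 'b::vector_lattice \<Rightarrow> 'g) \<Rightarrow> bool" where
  "lattice_bimorphism_into G \<Phi> \<longleftrightarrow>
     (\<forall>x. linear_into G (\<Phi> x)) \<and>
     (\<forall>y. linear_into G (\<lambda>x. \<Phi> x y)) \<and>
     (\<forall>x\<ge>0. lattice_hom_into G (\<Phi> x)) \<and>
     (\<forall>y\<ge>0. lattice_hom_into G (\<lambda>x. \<Phi> x y))"

lemma linear_into_type_space: "linear_into type_space h \<longleftrightarrow> linear h"
  by (auto simp: linear_into_def intro: linearI linear_add linear_scale)

instantiation poly_mapping :: (type, real_vector) real_vector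
begin

lift_definition scaleR_poly_mapping :: "real \<Rightarrow> ('a \<Rightarrow>\<^sub>0 'b) \<Rightarrow> 'a \<Rightarrow>\<^sub>0 'b"
  is "\<lambda>c f k. c *\<^sub>R f k"
  by (erule rev_finite_subset) auto

instance
proof
  fix p q :: "'a \<Rightarrow>\<^sub>0 'b" and c d :: real
  show "c *\<^sub>R (p + q) = c *\<^sub>R p + c *\<^sub>R q"
    by transfer (simp add: scaleR_add_right)
  show "(c + d) *\<^sub>R p = c *\<^sub>R p + d *\<^sub>R p"
    by transfer (simp add: scaleR_add_left)
  show "c *\<^sub>R d *\<^sub>R p = (c * d) *\<^sub>R p"
    by transfer simp
  show "1 *\<^sub>R p = p"
    by transfer simp
qed

end

text \<open>
  \<open>'e \<times> 'f \<Rightarrow>\<^sub>0 real\<close> is the free vector space on the set of pairs; the algebraic tensor product is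
  its quotient by the bilinearity relations.
\<close>

definition pair_gen :: "'e \<Rightarrow> 'f \<Rightarrow> ('e \<times> 'f) \<Rightarrow>\<^sub>0 real" where
  "pair_gen x y = Poly_Mapping.single (x, y) 1"

definition bilinearity_relations :: "(('e::real_vector \<times> 'f::real_vector) \<Rightarrow>\<^sub>0 real) set" where
  "bilinearity_relations =
     {pair_gen (x + x') y - pair_gen x y - pair_gen x' y | x x' y. True} \<union>
     {pair_gen x (y + y') - pair_gen x y - pair_gen x y' | x y y'. True} \<union>
     {pair_gen (c *\<^sub>R x) y - c *\<^sub>R pair_gen x y | c x y. True} \<union>
     {pair_gen x (c *\<^sub>R y) - c *\<^sub>R pair_gen x y | c x y. True}"

definition tensor_eq ::
    "(('e::real_vector \<times> 'f::real_vector) \<Rightarrow>\<^sub>0 real) \<Rightarrow> (('e \<times> 'f) \<Rightarrow>\<^sub>0 real) \<Rightarrow> bool" where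
  "tensor_eq p q \<longleftrightarrow> p - q \<in> span bilinearity_relations"

lemma equivp_tensor_eq: "equivp tensor_eq"
proof (rule equivpI)
  show "reflp tensor_eq"
    by (auto simp: reflp_def tensor_eq_def span_zero)
  show "symp tensor_eq"
    unfolding symp_def tensor_eq_def using span_neg by fastforce
  show "transp tensor_eq"
    unfolding transp_def tensor_eq_def
    using span_add[of "_ - _" bilinearity_relations "_ - _"] by fastforce
qed

quotient_type (overloaded) ('e, 'f) alg_tensor =
  "('e::real_vector \<times> 'f::real_vector) \<Rightarrow>\<^sub>0 real" / tensor_eq
  by (rule equivp_tensor_eq)

instantiation alg_tensor :: (real_vector, real_vector) real_vector
begin

lift_definition zero_alg_tensor :: "('a, 'b) alg_tensor" is 0 .

lift_definition plus_alg_tensor ::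
  "('a, 'b) alg_tensor \<Rightarrow> ('a, 'b) alg_tensor \<Rightarrow> ('a, 'b) alg_tensor" is "(+)"
  unfolding tensor_eq_def by (metis add_diff_add span_add)

lift_definition minus_alg_tensor ::
  "('a, 'b) alg_tensor \<Rightarrow> ('a, 'b) alg_tensor \<Rightarrow> ('a, 'b) alg_tensor" is "(-)"
proof -
  fix p p' q q' :: "('a \<times> 'b) \<Rightarrow>\<^sub>0 real"
  assume "tensor_eq p p'" "tensor_eq q q'"
  then have "(p - p') - (q - q') \<in> span bilinearity_relations"
    unfolding tensor_eq_def by (rule span_diff)
  moreover have "(p - p') - (q - q') = (p - q) - (p' - q')"
    by (simp add: algebra_simps)
  ultimately show "tensor_eq (p - q) (p' - q')"
    by (simp add: tensor_eq_def)
qed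

lift_definition uminus_alg_tensor ::
  "('a, 'b) alg_tensor \<Rightarrow> ('a, 'b) alg_tensor" is uminus
  unfolding tensor_eq_def by (metis minus_diff_minus span_neg)

lift_definition scaleR_alg_tensor ::
  "real \<Rightarrow> ('a, 'b) alg_tensor \<Rightarrow> ('a, 'b) alg_tensor" is "(*\<^sub>R)"
  unfolding tensor_eq_def by (metis scaleR_diff_right span_scale)

lemma tensor_eq_refl: "p = q \<Longrightarrow> tensor_eq p q"
  by (simp add: tensor_eq_def span_zero)

instance
proof
  fix p q r :: "('a, 'b) alg_tensor" and c d :: real
  show "p + q + r = p + (q + r)"
    by transfer (rule tensor_eq_refl, rule add.assoc)
  show "p + q = q + p"
    by transfer (rule tensor_eq_refl, rule add.commute)
  show "0 + p = p"
    by transfer (rule tensor_eq_refl, simp)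
  show "- p + p = 0"
    by transfer (rule tensor_eq_refl, simp)
  show "p - q = p + - q"
    by transfer (rule tensor_eq_refl, simp)
  show "c *\<^sub>R (p + q) = c *\<^sub>R p + c *\<^sub>R q"
    by transfer (rule tensor_eq_refl, rule scaleR_add_right)
  show "(c + d) *\<^sub>R p = c *\<^sub>R p + d *\<^sub>R p"
    by transfer (rule tensor_eq_refl, rule scaleR_add_left)
  show "c *\<^sub>R d *\<^sub>R p = (c * d) *\<^sub>R p"
    by transfer (rule tensor_eq_refl, simp)
  show "1 *\<^sub>R p = p"
    by transfer (rule tensor_eq_refl, simp)
qed

end

lift_definition tensor :: "'e::real_vector \<Rightarrow> 'f::real_vector \<Rightarrow> ('e, 'f) alg_tensor" is pair_gen .

lemma bilinear_tensor:
  fixes x x' :: "'a::real_vector" and y y' :: "'b::real_vector"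
  shows
  "tensor (x + x') y = tensor x y + tensor x' y"
  "tensor x (y + y') = tensor x y + tensor x y'"
  "tensor (c *\<^sub>R x) y = c *\<^sub>R tensor x y"
  "tensor x (c *\<^sub>R y) = c *\<^sub>R tensor x y"
proof -
  have base: "tensor_eq p q" if "p - q \<in> bilinearity_relations"
    for p q :: "('a \<times> 'b) \<Rightarrow>\<^sub>0 real"
    using that by (simp add: tensor_eq_def span_base)
  show "tensor (x + x') y = tensor x y + tensor x' y"
    by transfer (rule base, unfold bilinearity_relations_def diff_diff_eq[symmetric], blast)
  show "tensor x (y + y') = tensor x y + tensor x y'"
    by transfer (rule base, unfold bilinearity_relations_def diff_diff_eq[symmetric], blast)
  show "tensor (c *\<^sub>R x) y = c *\<^sub>R tensor x y"
    by transfer (rule base, unfold bilinearity_relations_def, blast)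
  show "tensor x (c *\<^sub>R y) = c *\<^sub>R tensor x y"
    by transfer (rule base, unfold bilinearity_relations_def, blast)
qed

text \<open>
  The type \<open>'t\<close> with the embedding \<open>\<iota>\<close> of the algebraic tensor product is a Fremlin tensor product
  of \<open>'e\<close> and \<open>'f\<close>. The universal property is required for all Archimedean vector lattices whose
  underlying set is a subset of \<open>'t\<close>, with arbitrary operations and order. This already implies it
  for all Archimedean vector lattices: only the vector sublattice generated by the range of \<open>\<Phi>\<close>
  matters, and the injectivity of \<open>\<iota>\<close> makes its cardinality at most that of \<open>'t\<close>
  (if \<open>'e\<close> or \<open>'f\<close> is trivial, then so are \<open>\<Phi>\<close> and \<open>'t\<close>).
\<close>

definition fremlin_tensor_product ::
    "(('e::archimedean_vector_lattice, 'f::archimedean_vector_lattice) alg_tensor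
      \<Rightarrow> 't::archimedean_vector_lattice) \<Rightarrow> bool" where
  "fremlin_tensor_product \<iota> \<longleftrightarrow>
     linear \<iota> \<and> inj \<iota> \<and>
     vector_sublattice hull (range \<iota>) = UNIV \<and>
     lattice_bimorphism_into type_space (\<lambda>x y. \<iota> (tensor x y)) \<and>
     (\<forall>(G :: 't ordered_space) \<Phi>.
        carrier_archimedean_vector_lattice G \<longrightarrow> lattice_bimorphism_into G \<Phi> \<longrightarrow>
        (\<exists>!T. lattice_hom_into G T \<and> (\<forall>x y. T (\<iota> (tensor x y)) = \<Phi> x y)))"

end

theory Submission
  imports Defs
begin

text \<open>
  If \<open>\<bar>f\<^sub>0\<bar> \<le> u\<close> and \<open>\<bar>g\<^sub>0\<bar> \<le> v\<close>, then \<open>\<bar>f \<otimes> g - f\<^sub>0 \<otimes> g\<^sub>0\<bar> \<and> (u \<otimes> v)\<close> is at most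
  \<open>2 (\<bar>f - f\<^sub>0\<bar> \<and> u) \<otimes> v + 2 u \<otimes> (\<bar>g - g\<^sub>0\<bar> \<and> v)\<close>, and every element of the tensor product lies below
  some \<open>u \<otimes> v\<close>. It remains to see that \<open>p\<^sub>\<gamma> \<down> 0\<close> implies \<open>p\<^sub>\<gamma> \<otimes> e \<down> 0\<close>.

  Suppose \<open>w \<le> p\<^sub>\<gamma> \<otimes> e\<close> for all \<open>\<gamma>\<close> but \<open>w \<le> 0\<close> fails; enlarging \<open>e\<close>, we may assume that it
  dominates all elements of the second factor occurring in \<open>w\<close>. Localizing in the second variable to
  some \<open>b > 0\<close> on which these elements are almost constant multiples of \<open>e\<close>, we get \<open>w \<approx> z \<otimes> e\<close> on
  \<open>b\<close>, with error at most \<open>\<epsilon> u \<otimes> e\<close>. Products of nonzero elements being nonzero, this forces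
  \<open>z - \<epsilon> u \<le> p\<^sub>\<gamma>\<close> for all \<open>\<gamma>\<close>, so \<open>z \<le> \<epsilon> u\<close> and \<open>w \<le> 2 \<epsilon> u \<otimes> e\<close> on \<open>b\<close>. By the Archimedean
  property some \<open>\<epsilon>\<close> and \<open>b\<close> contradict this. Of the Fremlin tensor product only the following is used: it
  is generated by the elementary tensors, \<open>\<otimes>\<close> is a lattice bimorphism, and \<open>x \<otimes> y = 0\<close> only if
  \<open>x = 0\<close> or \<open>y = 0\<close>.
\<close>

subsection \<open>Vector lattices\<close>

lemma scaleR_inf:
  fixes x y :: "'a::vector_lattice"
  assumes "0 \<le> c"
  shows "c *\<^sub>R inf x y = inf (c *\<^sub>R x) (c *\<^sub>R y)"
proof (cases "c = 0")
  case False
  with assms have c: "0 < c" by simp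
  show ?thesis
  proof (rule order.antisym)
    show "c *\<^sub>R inf x y \<le> inf (c *\<^sub>R x) (c *\<^sub>R y)"
      using assms by (simp add: scaleR_left_mono)
    have "(1 / c) *\<^sub>R inf (c *\<^sub>R x) (c *\<^sub>R y) \<le> x" "(1 / c) *\<^sub>R inf (c *\<^sub>R x) (c *\<^sub>R y) \<le> y"
      using scaleR_left_mono[OF inf_le1[of "c *\<^sub>R x" "c *\<^sub>R y"], of "1 / c"]
        scaleR_left_mono[OF inf_le2[of "c *\<^sub>R x" "c *\<^sub>R y"], of "1 / c"] c by simp_all
    then have "(1 / c) *\<^sub>R inf (c *\<^sub>R x) (c *\<^sub>R y) \<le> inf x y"
      by simp
    from scaleR_left_mono[OF this assms] show "inf (c *\<^sub>R x) (c *\<^sub>R y) \<le> c *\<^sub>R inf x y"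
      using c by simp
  qed
qed simp

lemma abs_scaleR_lattice:
  fixes x :: "'a::vector_lattice"
  shows "\<bar>c *\<^sub>R x\<bar> \<le> \<bar>c\<bar> *\<^sub>R \<bar>x\<bar>"
proof (cases "0 \<le> c")
  case True
  have "c *\<^sub>R x \<le> c *\<^sub>R \<bar>x\<bar>" "- (c *\<^sub>R x) \<le> c *\<^sub>R \<bar>x\<bar>"
    using scaleR_left_mono[OF abs_ge_self True] scaleR_left_mono[OF abs_ge_minus_self[of x] True]
    by simp_all
  with True show ?thesis by (simp add: abs_le_iff)
next
  case False
  then have c: "0 \<le> - c" by simp
  have "c *\<^sub>R x \<le> (- c) *\<^sub>R \<bar>x\<bar>" "- (c *\<^sub>R x) \<le> (- c) *\<^sub>R \<bar>x\<bar>"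
    using scaleR_left_mono[OF abs_ge_self[of x] c] scaleR_left_mono[OF abs_ge_minus_self[of x] c]
    by simp_all
  with False show ?thesis by (simp add: abs_le_iff)
qed

text \<open>The left side lies below both \<open>c + inf c b\<close> and \<open>a + inf c b\<close>.
  Addition distributes over \<open>inf\<close>, so the infimum of these two is the right
  side.\<close>

lemma inf_add_le:
  fixes a b c :: "'a::vector_lattice"
  assumes "0 \<le> a" "0 \<le> b" "0 \<le> c"
  shows "inf c (a + b) \<le> inf c a + inf c b"
proof -
  let ?m = "inf c (a + b)"
  have "?m \<le> c + inf c b"
    using assms by (meson add_increasing2 inf.coboundedI1 le_inf_iff order.refl)
  moreover have "?m \<le> a + inf c b"
    unfolding add_inf_distrib_left using assms by (simp add: add_increasing le_infI1)
  ultimately show ?thesis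
    by (simp add: add_inf_distrib_right)
qed

lemma disjoint_add:
  fixes a b c :: "'a::vector_lattice"
  assumes "0 \<le> a" "0 \<le> b" "0 \<le> c" "inf a c = 0" "inf b c = 0"
  shows "inf (a + b) c = 0"
proof (rule order.antisym)
  show "inf (a + b) c \<le> 0"
    using inf_add_le[of a b c] assms by (simp add: inf.commute)
qed (use assms in simp)

lemma disjoint_scaleR:
  fixes a b :: "'a::vector_lattice"
  assumes "0 \<le> a" "0 \<le> b" "0 \<le> c" "inf a b = 0"
  shows "inf (c *\<^sub>R a) b = 0"
proof (rule order.antisym)
  \<comment> \<open>The factor \<open>1 + c\<close> dominates both \<open>c\<close> and 1, and it
    can be pulled out of the infimum.\<close>
  have "inf (c *\<^sub>R a) b \<le> inf ((1 + c) *\<^sub>R a) ((1 + c) *\<^sub>R b)"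
    using assms
    by (intro inf_mono) (simp_all add: scaleR_add_left add_increasing add_increasing2 scaleR_nonneg_nonneg)
  also have "\<dots> = 0"
    using assms by (simp flip: scaleR_inf)
  finally show "inf (c *\<^sub>R a) b \<le> 0" .
qed (use assms in \<open>simp add: scaleR_nonneg_nonneg\<close>)

lemma disjoint_mono:
  fixes a b :: "'a::vector_lattice"
  assumes "0 \<le> a" "0 \<le> b" "a \<le> a'" "b \<le> b'" "inf a' b' = 0"
  shows "inf a b = 0"
  using assms inf_mono[of a a' b b'] by (simp add: order.antisym)

lemma disjoint_pprt:
  fixes a :: "'a::vector_lattice"
  shows "inf (pprt a) (pprt (- a)) = 0"
proof -
  have "pprt a = pprt (- a) + a"
    using prts[symmetric, of a] by (simp add: pprt_neg eq_diff_eq)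
  then have "inf (pprt a) (pprt (- a)) = inf (pprt (- a) + a) (pprt (- a) + 0)"
    by simp
  also have "\<dots> = pprt (- a) + inf a 0"
    by (simp only: add_inf_distrib_left)
  also have "\<dots> = 0"
    by (simp add: pprt_neg flip: nprt_def)
  finally show ?thesis .
qed

lemma pprt_diff_inf:
  fixes x y :: "'a::vector_lattice"
  shows "inf x y + pprt (x - y) = x"
proof -
  have "x - inf x y = pprt (x - y)"
    by (simp add: diff_inf_eq_sup add_sup_distrib_left pprt_def sup.commute del: neg_inf_eq_sup)
  then show ?thesis by (metis add.commute diff_add_cancel)
qed

lemma inf_abs_add_le:
  fixes a b w :: "'a::vector_lattice"
  assumes "\<bar>d\<bar> \<le> a + b" "0 \<le> a" "0 \<le> b" "0 \<le> w"
  shows "inf \<bar>d\<bar> w \<le> inf a w + inf b w"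
proof -
  have "inf \<bar>d\<bar> w \<le> inf (a + b) w"
    using assms(1) by (rule inf_mono) simp
  also have "\<dots> \<le> inf a w + inf b w"
    using inf_add_le[of a b w] assms by (simp add: inf.commute)
  finally show ?thesis .
qed

text \<open>With \<open>c = d = 0\<close> this bounds \<open>\<bar>sup a b\<bar>\<close>; in general
  it passes approximations of \<open>a\<close> and \<open>b\<close> on to
  \<open>sup a b\<close>.\<close>

lemma abs_sup_diff_le:
  fixes a b c d :: "'a::vector_lattice"
  shows "\<bar>sup a b - sup c d\<bar> \<le> \<bar>a - c\<bar> + \<bar>b - d\<bar>"
proof -
  have *: "sup a b \<le> sup c d + (\<bar>a - c\<bar> + \<bar>b - d\<bar>)" for a b c d :: 'a
  proof -
    have "a \<le> c + \<bar>a - c\<bar>" "b \<le> d + \<bar>b - d\<bar>"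
      using abs_ge_self[of "a - c"] abs_ge_self[of "b - d"] by (simp_all only: diff_le_eq add.commute)
    moreover have "c + \<bar>a - c\<bar> \<le> c + (\<bar>a - c\<bar> + \<bar>b - d\<bar>)"
      "d + \<bar>b - d\<bar> \<le> d + (\<bar>a - c\<bar> + \<bar>b - d\<bar>)"
      by (intro add_left_mono add_increasing add_increasing2 abs_ge_zero order.refl)+
    ultimately have "a \<le> c + (\<bar>a - c\<bar> + \<bar>b - d\<bar>)" "b \<le> d + (\<bar>a - c\<bar> + \<bar>b - d\<bar>)"
      using order_trans by blast+
    then show ?thesis
      by (simp add: add_sup_distrib_right le_supI1 le_supI2)
  qed
  have "sup c d \<le> sup a b + (\<bar>a - c\<bar> + \<bar>b - d\<bar>)"
    using *[of c d a b] by (simp only: abs_minus_commute)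
  with *[of a b c d] show ?thesis
    by (intro abs_leI) (simp_all only: diff_le_eq minus_diff_eq add.commute)
qed

lemma abs_inf_diff_le:
  fixes a b c d :: "'a::vector_lattice"
  shows "\<bar>inf a b - inf c d\<bar> \<le> \<bar>a - c\<bar> + \<bar>b - d\<bar>"
proof -
  have "inf a b - inf c d = - (sup (- a) (- b) - sup (- c) (- d))"
    by (simp only: neg_sup_eq_inf minus_minus minus_diff_eq flip: neg_inf_eq_sup) simp
  then have "\<bar>inf a b - inf c d\<bar> = \<bar>sup (- a) (- b) - sup (- c) (- d)\<bar>"
    by (simp only: abs_minus_cancel)
  also have "\<dots> \<le> \<bar>- a - - c\<bar> + \<bar>- b - - d\<bar>"
    by (rule abs_sup_diff_le)
  also have "\<dots> = \<bar>a - c\<bar> + \<bar>b - d\<bar>"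
    by (simp only: minus_diff_minus abs_minus_cancel)
  finally show ?thesis .
qed

lemma archimedean_eps:
  fixes x y :: "'a::archimedean_vector_lattice"
  assumes "\<And>\<epsilon>. 0 < \<epsilon> \<Longrightarrow> x \<le> \<epsilon> *\<^sub>R y" and y: "0 \<le> y"
  shows "x \<le> 0"
proof (rule archimedean)
  fix n :: nat
  show "real n *\<^sub>R x \<le> y"
  proof (cases "n = 0")
    case False
    have "real n *\<^sub>R x \<le> real n *\<^sub>R (1 / real n) *\<^sub>R y"
      using False by (intro scaleR_left_mono assms) simp_all
    with False show ?thesis by simp
  qed (use y in simp)
qed

text \<open>The set \<open>S\<close> indexes itself under the reversed order, with the identity as
  dominating net; this fits the index type prescribed by \<open>order_converges\<close>.\<close>

lemma order_convergesI:
  fixes x :: "'i \<Rightarrow> 'a::vector_lattice"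
  assumes "S \<noteq> {}"
    and "\<And>s t. s \<in> S \<Longrightarrow> t \<in> S \<Longrightarrow> \<exists>r\<in>S. r \<le> s \<and> r \<le> t"
    and "\<And>s. s \<in> S \<Longrightarrow> 0 \<le> s"
    and "\<And>z. (\<And>s. s \<in> S \<Longrightarrow> z \<le> s) \<Longrightarrow> z \<le> 0"
    and "\<And>s. s \<in> S \<Longrightarrow> \<exists>a0\<in>A. \<forall>a\<in>A. le a0 a \<longrightarrow> \<bar>x a - l\<bar> \<le> s"
  shows "order_converges A le x l"
  unfolding order_converges_def
proof (intro exI conjI)
  show "directed_set S (\<lambda>s t. t \<le> s)"
    using assms(1,2) unfolding directed_set_def by (auto intro: order_trans)
  show "decreases_to_zero S (\<lambda>s t. t \<le> s) (\<lambda>s. s)"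
    using assms(3,4) unfolding decreases_to_zero_def by auto
  show "\<forall>s\<in>S. \<exists>a0\<in>A. \<forall>a\<in>A. le a0 a \<longrightarrow> \<bar>x a - l\<bar> \<le> s"
    using assms(5) by blast
qed

subsection \<open>Nondegenerate lattice bimorphisms\<close>

locale nondegenerate_bimorphism =
  fixes \<Phi> :: "'e::archimedean_vector_lattice \<Rightarrow> 'f::archimedean_vector_lattice \<Rightarrow>
    't::archimedean_vector_lattice"
  assumes add_left: "\<Phi> (x + x') y = \<Phi> x y + \<Phi> x' y"
    and add_right: "\<Phi> x (y + y') = \<Phi> x y + \<Phi> x y'"
    and scaleR_left: "\<Phi> (c *\<^sub>R x) y = c *\<^sub>R \<Phi> x y"
    and scaleR_right: "\<Phi> x (c *\<^sub>R y) = c *\<^sub>R \<Phi> x y"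
    and inf_left: "0 \<le> y \<Longrightarrow> \<Phi> (inf x x') y = inf (\<Phi> x y) (\<Phi> x' y)"
    and inf_right: "0 \<le> x \<Longrightarrow> \<Phi> x (inf y y') = inf (\<Phi> x y) (\<Phi> x y')"
    and eq_zero: "\<Phi> x y = 0 \<Longrightarrow> x = 0 \<or> y = 0"
    and generates: "vector_sublattice hull {\<Phi> x y | x y. True} = UNIV"
begin

lemma flip: "nondegenerate_bimorphism (\<lambda>y x. \<Phi> x y)"
proof
  have "{\<Phi> x y | y x. True} = {\<Phi> x y | x y. True}" by blast
  with generates show "vector_sublattice hull {\<Phi> x y | y x. True} = UNIV" by (simp only:)
next
  show "y = 0 \<or> x = 0" if "\<Phi> x y = 0" for x y
    using eq_zero[OF that] by blast
qed (rule add_left add_right scaleR_left scaleR_right inf_left inf_right; assumption?)+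

lemma zero_left [simp]: "\<Phi> 0 y = 0"
  using scaleR_left[of 0 0 y] by simp

lemma zero_right [simp]: "\<Phi> x 0 = 0"
  using scaleR_right[of x 0 0] by simp

lemma minus_left: "\<Phi> (- x) y = - \<Phi> x y"
  using scaleR_left[of "-1" x y] by simp

lemma diff_left: "\<Phi> (x - x') y = \<Phi> x y - \<Phi> x' y"
  using add_left[of x "- x'" y] by (simp add: minus_left)

lemma diff_right: "\<Phi> x (y - y') = \<Phi> x y - \<Phi> x y'"
  using add_right[of x y "- y'"] scaleR_right[of x "-1" y'] by simp

lemma nonneg: "0 \<le> x \<Longrightarrow> 0 \<le> y \<Longrightarrow> 0 \<le> \<Phi> x y"
  using inf_left[of y 0 x] by (simp add: inf.absorb1 le_iff_inf)

lemma mono: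
  assumes "0 \<le> x" "0 \<le> y" "x \<le> x'" "y \<le> y'"
  shows "\<Phi> x y \<le> \<Phi> x' y'"
proof -
  have "\<Phi> x y \<le> \<Phi> x' y"
    using nonneg[of "x' - x" y] assms by (simp add: diff_left)
  also have "\<dots> \<le> \<Phi> x' y'"
    using nonneg[of x' "y' - y"] assms by (simp add: diff_right order_trans)
  finally show ?thesis .
qed

text \<open>The two products in the proof have nonnegative factors, and their sum is twice
  \<open>\<Phi> \<bar>x\<bar> \<bar>y\<bar> - \<Phi> x y\<close>.\<close>

lemma abs_le: "\<bar>\<Phi> x y\<bar> \<le> \<Phi> \<bar>x\<bar> \<bar>y\<bar>"
proof -
  have sum: "0 \<le> \<bar>z\<bar> + z" and diff: "0 \<le> \<bar>z\<bar> - z" for z :: "'z::vector_lattice"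
    using add_right_mono[OF abs_ge_minus_self[of z], of z] abs_ge_self[of z] by simp_all
  have *: "\<Phi> x y \<le> \<Phi> \<bar>x\<bar> \<bar>y\<bar>" for x
  proof -
    have "0 \<le> \<Phi> (\<bar>x\<bar> - x) (\<bar>y\<bar> + y) + \<Phi> (\<bar>x\<bar> + x) (\<bar>y\<bar> - y)"
      by (rule add_nonneg_nonneg; rule nonneg; rule sum diff)
    also have "\<dots> = (\<Phi> \<bar>x\<bar> \<bar>y\<bar> - \<Phi> x y) + (\<Phi> \<bar>x\<bar> \<bar>y\<bar> - \<Phi> x y)"
      by (simp add: add_left add_right diff_left diff_right algebra_simps)
    finally show ?thesis
      by simp
  qed
  show ?thesis
    using *[of x] *[of "- x"] by (simp add: abs_le_iff minus_left)
qed

lemma sup_left: "0 \<le> y \<Longrightarrow> \<Phi> (sup x x') y = sup (\<Phi> x y) (\<Phi> x' y)"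
  by (simp only: sup_eq_neg_inf minus_left inf_left)

lemma pprt_left:
  assumes "0 \<le> y"
  shows "\<Phi> (pprt x) y = pprt (\<Phi> x y)"
  using sup_left[OF assms, of x 0] by (simp add: pprt_def)

text \<open>Replacing \<open>y\<close> and \<open>y'\<close> by their sum enlarges both products and
  gives them the common second factor that \<open>inf_left\<close> requires.\<close>

lemma disjoint_left:
  assumes "0 \<le> x" "0 \<le> x'" "0 \<le> y" "0 \<le> y'" "inf x x' = 0"
  shows "inf (\<Phi> x y) (\<Phi> x' y') = 0"
proof (rule disjoint_mono)
  show "0 \<le> \<Phi> x y" "0 \<le> \<Phi> x' y'"
    using assms by (simp_all add: nonneg)
  show "\<Phi> x y \<le> \<Phi> x (y + y')" "\<Phi> x' y' \<le> \<Phi> x' (y + y')"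
    using assms by (simp_all add: add_right nonneg)
  show "inf (\<Phi> x (y + y')) (\<Phi> x' (y + y')) = 0"
    using inf_left[of "y + y'" x x'] assms by simp
qed

lemma disjoint_right:
  assumes "0 \<le> x" "0 \<le> x'" "0 \<le> y" "0 \<le> y'" "inf y y' = 0"
  shows "inf (\<Phi> x y) (\<Phi> x' y') = 0"
  using assms nondegenerate_bimorphism.disjoint_left[OF flip] by blast

text \<open>Read pointwise: where \<open>x\<close> exceeds \<open>u\<close> or \<open>y\<close>
  exceeds \<open>v\<close>, the right side is at least \<open>u v\<close>; elsewhere it is at least
  \<open>x v\<close>, hence at least \<open>x y\<close>.\<close>

lemma inf_le:
  assumes "0 \<le> x" "0 \<le> y" "0 \<le> u" "0 \<le> v"
  shows "inf (\<Phi> x y) (\<Phi> u v) \<le> \<Phi> (inf x u) v + \<Phi> u (inf y v)"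
proof -
  let ?d = "pprt (x - u)" and ?d' = "pprt (u - x)"
  have x: "x = inf x u + ?d" and u: "u = inf x u + ?d'"
    using pprt_diff_inf[of x u] pprt_diff_inf[of u x] by (simp_all add: inf.commute)
  have pos: "0 \<le> inf x u" using assms by simp
  \<comment> \<open>Only \<open>\<Phi> ?d y\<close> can exceed the bound, and it is disjoint from \<open>\<Phi> ?d' v\<close>.\<close>
  have "inf (\<Phi> x y) (\<Phi> u v) = inf (\<Phi> u v) (\<Phi> (inf x u) y + \<Phi> ?d y)"
    by (subst x) (simp add: add_left inf.commute)
  also have "\<dots> \<le> inf (\<Phi> u v) (\<Phi> (inf x u) y) + inf (\<Phi> u v) (\<Phi> ?d y)"
    using assms pos by (intro inf_add_le nonneg) simp_all
  also have "inf (\<Phi> u v) (\<Phi> (inf x u) y) \<le> inf (\<Phi> u v) (\<Phi> u y)"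
    using assms pos by (intro inf_mono mono) simp_all
  also have "\<dots> = \<Phi> u (inf y v)"
    using assms by (simp add: inf_right inf.commute)
  also have "inf (\<Phi> u v) (\<Phi> ?d y) = inf (\<Phi> ?d y) (\<Phi> (inf x u) v + \<Phi> ?d' v)"
    by (subst u) (simp add: add_left inf.commute)
  also have "\<dots> \<le> inf (\<Phi> ?d y) (\<Phi> (inf x u) v) + inf (\<Phi> ?d y) (\<Phi> ?d' v)"
    using assms pos by (intro inf_add_le nonneg) simp_all
  also have "inf (\<Phi> ?d y) (\<Phi> ?d' v) = 0"
    using assms disjoint_pprt[of "x - u"] by (intro disjoint_left) simp_all
  also have "inf (\<Phi> ?d y) (\<Phi> (inf x u) v) \<le> \<Phi> (inf x u) v"
    by simp
  finally show ?thesis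
    by (simp add: add.commute)
qed

text \<open>The elements dominated by a product form a vector sublattice containing all products.
  Closure under sums holds because \<open>\<Phi> u v + \<Phi> u' v'\<close> lies below
  \<open>\<Phi> (u + u') (v + v')\<close>.\<close>

lemma abs_le_simple:
  obtains u v where "0 \<le> u" "0 \<le> v" "\<bar>w\<bar> \<le> \<Phi> u v"
proof -
  let ?P = "\<lambda>w. \<exists>u\<ge>0. \<exists>v\<ge>0. \<bar>w\<bar> \<le> \<Phi> u v"
  have dom: "?P c" if "?P a" "?P b" "\<bar>c\<bar> \<le> \<bar>a\<bar> + \<bar>b\<bar>" for a b c
  proof -
    from that obtain u v u' v' where *: "0 \<le> u" "0 \<le> v" "\<bar>a\<bar> \<le> \<Phi> u v"
      "0 \<le> u'" "0 \<le> v'" "\<bar>b\<bar> \<le> \<Phi> u' v'" by blast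
    have "\<bar>c\<bar> \<le> \<Phi> u v + \<Phi> u' v'"
      by (rule order_trans[OF that(3) add_mono[OF *(3,6)]])
    also have "\<dots> \<le> \<Phi> u (v + v') + \<Phi> u' (v + v')"
      using * by (intro add_mono mono) (simp_all add: add_increasing)
    finally show ?thesis
      using * by (intro exI[of _ "u + u'"] exI[of _ "v + v'"] conjI) (simp_all add: add_left)
  qed
  have "?P w"
  proof (rule hull_induct[of w vector_sublattice "{\<Phi> x y | x y. True}"])
    show "w \<in> vector_sublattice hull {\<Phi> x y | x y. True}"
      unfolding generates by simp
    show "?P x" if "x \<in> {\<Phi> x y | x y. True}" for x
    proof -
      from that obtain a b where "x = \<Phi> a b" by blast
      then show ?thesis
        using abs_le[of a b] by (intro exI[of _ "\<bar>a\<bar>"] exI[of _ "\<bar>b\<bar>"] conjI) simp_all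
    qed
    show "vector_sublattice {w. ?P w}"
      unfolding vector_sublattice_def
    proof (intro conjI subspaceI ballI; unfold mem_Collect_eq)
      show "?P 0" by (intro exI[of _ 0] conjI) simp_all
      show "?P (a + b)" if "?P a" "?P b" for a b
        using that by (rule dom) (rule abs_triangle_ineq)
      show "?P (sup a b)" if "?P a" "?P b" for a b
        using that by (rule dom) (use abs_sup_diff_le[of a b 0 0] in simp)
      show "?P (inf a b)" if "?P a" "?P b" for a b
        using that by (rule dom) (use abs_inf_diff_le[of a b 0 0] in simp)
      show "?P (c *\<^sub>R a)" if a: "?P a" for a c
      proof -
        from a obtain u v where *: "0 \<le> u" "0 \<le> v" "\<bar>a\<bar> \<le> \<Phi> u v" by blast
        have "\<bar>c *\<^sub>R a\<bar> \<le> \<bar>c\<bar> *\<^sub>R \<Phi> u v"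
          by (rule order_trans[OF abs_scaleR_lattice scaleR_left_mono[OF *(3) abs_ge_zero]])
        with * show ?thesis
          by (intro exI[of _ "\<bar>c\<bar> *\<^sub>R u"] exI[of _ v] conjI)
            (simp_all add: scaleR_left scaleR_nonneg_nonneg)
      qed
    qed
  qed
  with that show ?thesis by blast
qed

subsection \<open>Localization in the second variable\<close>

text \<open>
  Read \<open>\<Phi>\<close> as a product of functions, with \<open>e\<close> in the role of the constant \<open>1\<close>. Up to the relative error
  \<open>\<epsilon>\<close>, on the support of \<open>b\<close> the element \<open>w\<close> does not depend on the second variable and agrees
  with \<open>z\<close> there; the remainder \<open>r\<close> lives off the support of \<open>b\<close>.
\<close>

definition near_on where
  "near_on w e u \<epsilon> b z \<longleftrightarrow>
     (\<exists>r\<ge>0. \<bar>w - \<Phi> z e\<bar> \<le> \<epsilon> *\<^sub>R \<Phi> u e + r \<and> (\<forall>x\<ge>0. inf r (\<Phi> x b) = 0))"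

text \<open>
  The element \<open>t\<close> keeps the localization from escaping to a part of the space where nothing is to be
  shown.
\<close>

definition localizable where
  "localizable w e \<longleftrightarrow>
     (\<exists>u\<ge>0. \<forall>\<epsilon>>0. \<forall>t\<ge>0. \<forall>x0\<ge>0. \<forall>b0\<ge>0. b0 \<le> e \<longrightarrow> inf t (\<Phi> x0 b0) \<noteq> 0 \<longrightarrow>
        (\<exists>b\<ge>0. \<exists>z. b \<le> b0 \<and> inf t (\<Phi> x0 b) \<noteq> 0 \<and> near_on w e u \<epsilon> b z))"

lemma near_on_mono:
  assumes "near_on w e u \<epsilon> b z" "0 \<le> b'" "b' \<le> b"
  shows "near_on w e u \<epsilon> b' z"
proof -
  obtain r where r: "0 \<le> r" "\<bar>w - \<Phi> z e\<bar> \<le> \<epsilon> *\<^sub>R \<Phi> u e + r" "\<forall>x\<ge>0. inf r (\<Phi> x b) = 0"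
    using assms(1) unfolding near_on_def by (elim exE conjE)
  have "inf r (\<Phi> x b') = 0" if "0 \<le> x" for x
    using disjoint_mono[OF r(1) nonneg[OF that assms(2)] order.refl mono[OF that assms(2) order.refl assms(3)]]
      r(3)[rule_format, OF that] .
  with r(1,2) show ?thesis
    unfolding near_on_def by blast
qed

text \<open>The hypothesis on \<open>w''\<close> covers sums, suprema and infima at once. Errors
  add, but the growth goes into \<open>u + u'\<close>, so \<epsilon> stays the same.\<close>

lemma near_on_combine:
  assumes "near_on w e u \<epsilon> b z" "near_on w' e u' \<epsilon> b z'" "0 \<le> b"
    and "\<bar>w'' - \<Phi> z'' e\<bar> \<le> \<bar>w - \<Phi> z e\<bar> + \<bar>w' - \<Phi> z' e\<bar>"
  shows "near_on w'' e (u + u') \<epsilon> b z''"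
proof -
  obtain r where r: "0 \<le> r" "\<bar>w - \<Phi> z e\<bar> \<le> \<epsilon> *\<^sub>R \<Phi> u e + r" "\<forall>x\<ge>0. inf r (\<Phi> x b) = 0"
    using assms(1) unfolding near_on_def by (elim exE conjE)
  obtain r' where r': "0 \<le> r'" "\<bar>w' - \<Phi> z' e\<bar> \<le> \<epsilon> *\<^sub>R \<Phi> u' e + r'"
      "\<forall>x\<ge>0. inf r' (\<Phi> x b) = 0"
    using assms(2) unfolding near_on_def by (elim exE conjE)
  have "\<bar>w'' - \<Phi> z'' e\<bar> \<le> (\<epsilon> *\<^sub>R \<Phi> u e + r) + (\<epsilon> *\<^sub>R \<Phi> u' e + r')"
    by (rule order_trans[OF assms(4) add_mono[OF r(2) r'(2)]])
  also have "\<dots> = \<epsilon> *\<^sub>R \<Phi> (u + u') e + (r + r')"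
    by (simp add: add_left scaleR_add_right ac_simps)
  finally have "\<bar>w'' - \<Phi> z'' e\<bar> \<le> \<epsilon> *\<^sub>R \<Phi> (u + u') e + (r + r')" .
  moreover have "inf (r + r') (\<Phi> x b) = 0" if "0 \<le> x" for x
    using disjoint_add[OF r(1) r'(1) nonneg[OF that assms(3)]] r(3) r'(3) that by simp
  moreover have "0 \<le> r + r'" using r(1) r'(1) by (rule add_nonneg_nonneg)
  ultimately show ?thesis
    unfolding near_on_def by blast
qed

text \<open>Two localizations in succession: the second starts from the \<open>b\<close> of the
  first, since \<open>\<Phi> x0 b\<close> still meets \<open>t\<close>, and
  \<open>near_on_mono\<close> carries the first approximation to the smaller
  \<open>b'\<close>.\<close>

lemma localizable_combine:
  assumes w: "localizable w e" and w': "localizable w' e"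
    and comb: "\<And>z z'. \<exists>z''. \<bar>w'' - \<Phi> z'' e\<bar> \<le> \<bar>w - \<Phi> z e\<bar> + \<bar>w' - \<Phi> z' e\<bar>"
  shows "localizable w'' e"
proof -
  obtain u where u: "0 \<le> u" "\<forall>\<epsilon>>0. \<forall>t\<ge>0. \<forall>x0\<ge>0. \<forall>b0\<ge>0. b0 \<le> e \<longrightarrow> inf t (\<Phi> x0 b0) \<noteq> 0 \<longrightarrow>
      (\<exists>b\<ge>0. \<exists>z. b \<le> b0 \<and> inf t (\<Phi> x0 b) \<noteq> 0 \<and> near_on w e u \<epsilon> b z)"
    using w unfolding localizable_def by (elim exE conjE)
  obtain u' where u': "0 \<le> u'" "\<forall>\<epsilon>>0. \<forall>t\<ge>0. \<forall>x0\<ge>0. \<forall>b0\<ge>0. b0 \<le> e \<longrightarrow> inf t (\<Phi> x0 b0) \<noteq> 0 \<longrightarrow>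
      (\<exists>b\<ge>0. \<exists>z. b \<le> b0 \<and> inf t (\<Phi> x0 b) \<noteq> 0 \<and> near_on w' e u' \<epsilon> b z)"
    using w' unfolding localizable_def by (elim exE conjE)
  show ?thesis
    unfolding localizable_def
  proof (intro exI[of _ "u + u'"] conjI allI impI)
    show "0 \<le> u + u'" using u(1) u'(1) by (rule add_nonneg_nonneg)
  next
    fix \<epsilon> :: real and t x0 b0
    assume *: "0 < \<epsilon>" "0 \<le> t" "0 \<le> x0" "0 \<le> b0" "b0 \<le> e" "inf t (\<Phi> x0 b0) \<noteq> 0"
    obtain b z where b: "0 \<le> b" "b \<le> b0" "inf t (\<Phi> x0 b) \<noteq> 0" "near_on w e u \<epsilon> b z"
      using u(2)[rule_format, OF *] by blast
    obtain b' z' where b': "0 \<le> b'" "b' \<le> b" "inf t (\<Phi> x0 b') \<noteq> 0" "near_on w' e u' \<epsilon> b' z'"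
      using u'(2)[rule_format, OF *(1-3) b(1) order_trans[OF b(2) *(5)] b(3)] by blast
    obtain z'' where "\<bar>w'' - \<Phi> z'' e\<bar> \<le> \<bar>w - \<Phi> z e\<bar> + \<bar>w' - \<Phi> z' e\<bar>"
      using comb by blast
    then have "near_on w'' e (u + u') \<epsilon> b' z''"
      by (rule near_on_combine[OF near_on_mono[OF b(4) b'(1,2)] b'(4,1)])
    with b b' show "\<exists>b\<ge>0. \<exists>z. b \<le> b0 \<and> inf t (\<Phi> x0 b) \<noteq> 0 \<and> near_on w'' e (u + u') \<epsilon> b z"
      using order_trans by blast
  qed
qed

lemma localizable_scaleR:
  assumes "localizable w e"
  shows "localizable (c *\<^sub>R w) e"
proof -
  obtain u where u: "0 \<le> u" "\<forall>\<epsilon>>0. \<forall>t\<ge>0. \<forall>x0\<ge>0. \<forall>b0\<ge>0. b0 \<le> e \<longrightarrow> inf t (\<Phi> x0 b0) \<noteq> 0 \<longrightarrow>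
      (\<exists>b\<ge>0. \<exists>z. b \<le> b0 \<and> inf t (\<Phi> x0 b) \<noteq> 0 \<and> near_on w e u \<epsilon> b z)"
    using assms unfolding localizable_def by (elim exE conjE)
  have near: "near_on (c *\<^sub>R w) e (\<bar>c\<bar> *\<^sub>R u) \<epsilon> b (c *\<^sub>R z)"
    if near: "near_on w e u \<epsilon> b z" and "0 \<le> b" for \<epsilon> b z
  proof -
    obtain r where r: "0 \<le> r" "\<bar>w - \<Phi> z e\<bar> \<le> \<epsilon> *\<^sub>R \<Phi> u e + r" "\<forall>x\<ge>0. inf r (\<Phi> x b) = 0"
      using near unfolding near_on_def by (elim exE conjE)
    have "\<bar>c *\<^sub>R w - \<Phi> (c *\<^sub>R z) e\<bar> = \<bar>c *\<^sub>R (w - \<Phi> z e)\<bar>"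
      by (simp only: scaleR_left scaleR_diff_right)
    also have "\<dots> \<le> \<bar>c\<bar> *\<^sub>R \<bar>w - \<Phi> z e\<bar>"
      by (rule abs_scaleR_lattice)
    also have "\<dots> \<le> \<bar>c\<bar> *\<^sub>R (\<epsilon> *\<^sub>R \<Phi> u e + r)"
      using r(2) by (rule scaleR_left_mono) simp
    also have "\<dots> = \<epsilon> *\<^sub>R \<Phi> (\<bar>c\<bar> *\<^sub>R u) e + \<bar>c\<bar> *\<^sub>R r"
      by (simp add: scaleR_left scaleR_add_right mult.commute)
    finally have "\<bar>c *\<^sub>R w - \<Phi> (c *\<^sub>R z) e\<bar> \<le> \<epsilon> *\<^sub>R \<Phi> (\<bar>c\<bar> *\<^sub>R u) e + \<bar>c\<bar> *\<^sub>R r" .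
    moreover have "inf (\<bar>c\<bar> *\<^sub>R r) (\<Phi> x b) = 0" if "0 \<le> x" for x
      using r(1) nonneg[OF that \<open>0 \<le> b\<close>] abs_ge_zero r(3)[rule_format, OF that] by (rule disjoint_scaleR)
    moreover have "0 \<le> \<bar>c\<bar> *\<^sub>R r" using r(1) by (simp add: scaleR_nonneg_nonneg)
    ultimately show ?thesis
      unfolding near_on_def by blast
  qed
  show ?thesis
    unfolding localizable_def
  proof (intro exI[of _ "\<bar>c\<bar> *\<^sub>R u"] conjI allI impI)
    show "0 \<le> \<bar>c\<bar> *\<^sub>R u" using u(1) by (simp add: scaleR_nonneg_nonneg)
  next
    fix \<epsilon> :: real and t x0 b0
    assume *: "0 < \<epsilon>" "0 \<le> t" "0 \<le> x0" "0 \<le> b0" "b0 \<le> e" "inf t (\<Phi> x0 b0) \<noteq> 0"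
    show "\<exists>b\<ge>0. \<exists>z. b \<le> b0 \<and> inf t (\<Phi> x0 b) \<noteq> 0 \<and> near_on (c *\<^sub>R w) e (\<bar>c\<bar> *\<^sub>R u) \<epsilon> b z"
      using u(2)[rule_format, OF *] near by blast
  qed
qed

text \<open>
  Where \<open>y \<ge> a e\<close>, either \<open>y \<ge> (a + \<delta>) e\<close> on a part that still meets \<open>t\<close>, or
  \<open>a e \<le> y \<le> (a + 2 \<delta>) e\<close> on such a part. As \<open>y \<le> e\<close>, the first alternative cannot recur forever.
\<close>

lemma concentrate:
  assumes e: "0 \<le> e" "\<bar>y\<bar> \<le> e" and \<delta>: "0 < \<delta>" and t: "0 \<le> t" and x0: "0 \<le> x0"
    and b: "0 \<le> b" "b \<le> e" "inf t (\<Phi> x0 b) \<noteq> 0" "inf b (pprt (a *\<^sub>R e - y)) = 0"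
    and n: "1 < a + real n * \<delta>"
  shows "\<exists>b'\<ge>0. \<exists>c. b' \<le> b \<and> inf t (\<Phi> x0 b') \<noteq> 0 \<and> inf b' (pprt (\<bar>y - c *\<^sub>R e\<bar> - \<delta> *\<^sub>R e)) = 0"
  using b n
proof (induction n arbitrary: a b)
  case 0
  \<comment> \<open>Here \<open>a > 1\<close> while \<open>y \<le> e\<close>, so \<open>b\<close> is
    disjoint from a positive multiple of \<open>e\<close>, hence from \<open>e\<close>. As
    \<open>b \<le> e\<close>, this forces \<open>b = 0\<close>.\<close>
  then have a: "0 < a - 1" by simp
  have "y \<le> e" using e(2) abs_ge_self order_trans by blast
  then have "(a - 1) *\<^sub>R e \<le> a *\<^sub>R e - y"
    by (simp add: scaleR_diff_left)
  also have "\<dots> \<le> pprt (a *\<^sub>R e - y)" by (simp add: pprt_def)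
  finally have le: "(a - 1) *\<^sub>R e \<le> pprt (a *\<^sub>R e - y)" .
  have "0 \<le> (a - 1) *\<^sub>R e" using a e(1) by (simp add: scaleR_nonneg_nonneg)
  from disjoint_mono[OF "0.prems"(1) this order.refl le "0.prems"(4)]
  have "inf b ((a - 1) *\<^sub>R e) = 0" .
  then have "inf ((1 / (a - 1)) *\<^sub>R (a - 1) *\<^sub>R e) b = 0"
    using "0.prems"(1) a e(1)
    by - (rule disjoint_scaleR, simp_all add: scaleR_nonneg_nonneg inf.commute)
  then have "b = 0" using "0.prems"(2) a by (simp add: inf.absorb2)
  with "0.prems"(3) t show ?case by (simp add: inf.absorb2)
next
  case (Suc n)
  \<comment> \<open>The ranges above \<open>a + \<delta>\<close> and below
    \<open>a + 2 * \<delta>\<close> overlap, which gives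
    \<open>c1 + c2 \<ge> \<delta> *\<^sub>R e\<close>. After division by \<delta>, the pieces
    \<open>b1\<close> and \<open>b2\<close> together cover \<open>b\<close>, so one of them still
    meets \<open>t\<close>.\<close>
  define c1 where "c1 = pprt (y - (a + \<delta>) *\<^sub>R e)"
  define c2 where "c2 = pprt ((a + 2 * \<delta>) *\<^sub>R e - y)"
  define b1 where "b1 = inf b ((1 / \<delta>) *\<^sub>R c1)"
  define b2 where "b2 = inf b ((1 / \<delta>) *\<^sub>R c2)"
  have c: "0 \<le> c1" "0 \<le> c2" by (simp_all add: c1_def c2_def)
  have c': "0 \<le> (1 / \<delta>) *\<^sub>R c1" "0 \<le> (1 / \<delta>) *\<^sub>R c2"
    using c \<delta> by (simp_all add: scaleR_nonneg_nonneg)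
  have pos: "0 \<le> b1" "0 \<le> b2" using c' Suc.prems(1) by (simp_all add: b1_def b2_def)
  have le: "b1 \<le> b" "b2 \<le> b" by (simp_all add: b1_def b2_def)
  have step: "(a + 2 * \<delta>) *\<^sub>R e = (a + \<delta>) *\<^sub>R e + \<delta> *\<^sub>R e"
    by (simp flip: scaleR_add_left)
  have "\<delta> *\<^sub>R e = (y - (a + \<delta>) *\<^sub>R e) + ((a + 2 * \<delta>) *\<^sub>R e - y)"
    unfolding step by simp
  also have "\<dots> \<le> c1 + c2"
    unfolding c1_def c2_def pprt_def by (intro add_mono sup_ge1)
  finally have "(1 / \<delta>) *\<^sub>R \<delta> *\<^sub>R e \<le> (1 / \<delta>) *\<^sub>R (c1 + c2)"
    using \<delta> by (intro scaleR_left_mono) simp_all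
  then have "e \<le> (1 / \<delta>) *\<^sub>R c1 + (1 / \<delta>) *\<^sub>R c2"
    using \<delta> by (simp add: scaleR_add_right)
  then have "b = inf b ((1 / \<delta>) *\<^sub>R c1 + (1 / \<delta>) *\<^sub>R c2)"
    using order_trans[OF Suc.prems(2)] by (simp add: inf.absorb1)
  also have "\<dots> \<le> b1 + b2"
    unfolding b1_def b2_def using c' Suc.prems(1) by (rule inf_add_le)
  finally have "\<Phi> x0 b \<le> \<Phi> x0 b1 + \<Phi> x0 b2"
    using mono[OF x0 Suc.prems(1) order.refl, of "b1 + b2"] by (simp add: add_right)
  then have "inf t (\<Phi> x0 b) \<le> inf t (\<Phi> x0 b1 + \<Phi> x0 b2)"
    by (intro inf_mono order.refl)
  also have "\<dots> \<le> inf t (\<Phi> x0 b1) + inf t (\<Phi> x0 b2)"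
    using nonneg[OF x0 pos(1)] nonneg[OF x0 pos(2)] t by (rule inf_add_le)
  finally have "inf t (\<Phi> x0 b) \<le> inf t (\<Phi> x0 b1) + inf t (\<Phi> x0 b2)" .
  moreover have "0 \<le> inf t (\<Phi> x0 b)"
    using nonneg[OF x0 Suc.prems(1)] t by simp
  ultimately have "inf t (\<Phi> x0 b1) \<noteq> 0 \<or> inf t (\<Phi> x0 b2) \<noteq> 0"
    using Suc.prems(3) by (auto dest: order.antisym)
  then show ?case
  proof
    assume t1: "inf t (\<Phi> x0 b1) \<noteq> 0"
    \<comment> \<open>On \<open>b1\<close> the lower bound rises to \<open>a + \<delta>\<close> at
      the price of one unit of \<open>n\<close>, which preserves the last hypothesis.\<close>
    have "inf ((1 / \<delta>) *\<^sub>R c1) (pprt ((a + \<delta>) *\<^sub>R e - y)) = 0"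
      using c \<delta> disjoint_pprt[of "y - (a + \<delta>) *\<^sub>R e"]
      by - (rule disjoint_scaleR, simp_all add: c1_def)
    from disjoint_mono[OF pos(1) zero_le_pprt _ order.refl this]
    have "inf b1 (pprt ((a + \<delta>) *\<^sub>R e - y)) = 0"
      by (simp add: b1_def)
    moreover have "1 < a + \<delta> + real n * \<delta>"
      using Suc.prems(5) by (simp add: algebra_simps)
    ultimately obtain b' c' where "0 \<le> b'" "b' \<le> b1" "inf t (\<Phi> x0 b') \<noteq> 0"
        "inf b' (pprt (\<bar>y - c' *\<^sub>R e\<bar> - \<delta> *\<^sub>R e)) = 0"
      using Suc.IH[OF pos(1) order_trans[OF le(1) Suc.prems(2)] t1, of "a + \<delta>"] by blast
    with order_trans[OF \<open>b' \<le> b1\<close> le(1)] show ?thesis by blast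
  next
    assume t2: "inf t (\<Phi> x0 b2) \<noteq> 0"
    \<comment> \<open>Both \<open>?p\<close> and \<open>?q\<close> are disjoint from
      \<open>b2\<close>, so there \<open>y\<close> lies between \<open>a\<close> and
      \<open>a + 2 * \<delta>\<close> times \<open>e\<close>; the constant is the midpoint
      \<open>a + \<delta>\<close>.\<close>
    let ?p = "pprt (a *\<^sub>R e - y)" and ?q = "pprt (y - (a + 2 * \<delta>) *\<^sub>R e)"
    have "inf ((1 / \<delta>) *\<^sub>R c2) ?q = 0"
      using c \<delta> disjoint_pprt[of "(a + 2 * \<delta>) *\<^sub>R e - y"]
      by - (rule disjoint_scaleR, simp_all add: c2_def)
    from disjoint_mono[OF pos(2) zero_le_pprt _ order.refl this] have q: "inf b2 ?q = 0"
      by (simp add: b2_def)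
    have p: "inf b2 ?p = 0"
      by (rule disjoint_mono[OF pos(2) zero_le_pprt le(2) order.refl Suc.prems(4)])
    have "\<bar>y - (a + \<delta>) *\<^sub>R e\<bar> \<le> (?p + ?q) + \<delta> *\<^sub>R e"
    proof (rule abs_leI)
      have "y - (a + 2 * \<delta>) *\<^sub>R e \<le> ?p + ?q"
        by (rule add_increasing) (simp_all add: pprt_def)
      from add_right_mono[OF this, of "\<delta> *\<^sub>R e"]
      show "y - (a + \<delta>) *\<^sub>R e \<le> (?p + ?q) + \<delta> *\<^sub>R e"
        unfolding step by simp
      have "a *\<^sub>R e - y \<le> ?p + ?q"
        by (rule add_increasing2) (simp_all add: pprt_def)
      from add_right_mono[OF this, of "\<delta> *\<^sub>R e"]
      show "- (y - (a + \<delta>) *\<^sub>R e) \<le> (?p + ?q) + \<delta> *\<^sub>R e"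
        by (simp add: algebra_simps)
    qed
    then have le': "pprt (\<bar>y - (a + \<delta>) *\<^sub>R e\<bar> - \<delta> *\<^sub>R e) \<le> ?p + ?q"
      unfolding pprt_def[of "_ - \<delta> *\<^sub>R e"] by (intro sup_least) (simp_all add: diff_le_eq)
    have "inf (?p + ?q) b2 = 0"
      using p q by (intro disjoint_add zero_le_pprt pos(2)) (simp_all add: inf.commute)
    then have "inf b2 (?p + ?q) = 0" by (simp only: inf.commute)
    from disjoint_mono[OF pos(2) zero_le_pprt order.refl le' this]
    have "inf b2 (pprt (\<bar>y - (a + \<delta>) *\<^sub>R e\<bar> - \<delta> *\<^sub>R e)) = 0" .
    with t2 pos(2) le(2) show ?thesis by blast
  qed
qed

text \<open>Where \<open>y\<close> is close to \<open>c *\<^sub>R e\<close>, the product is close to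
  \<open>\<Phi> (c *\<^sub>R x) e\<close>. The excess of the error over
  \<open>\<epsilon> *\<^sub>R e\<close>, multiplied by \<open>\<bar>x\<bar>\<close>, is the
  remainder.\<close>

lemma localizable_simple:
  assumes e: "\<bar>y\<bar> \<le> e"
  shows "localizable (\<Phi> x y) e"
  unfolding localizable_def
proof (intro exI[of _ "\<bar>x\<bar>"] conjI allI impI)
  show "0 \<le> \<bar>x\<bar>" by simp
next
  fix \<epsilon> :: real and t x0 b0
  assume *: "0 < \<epsilon>" "0 \<le> t" "0 \<le> x0" "0 \<le> b0" "b0 \<le> e" "inf t (\<Phi> x0 b0) \<noteq> 0"
  have e0: "0 \<le> e" using e abs_ge_zero order_trans by blast
  \<comment> \<open>The search starts at \<open>a = -1\<close>, where
    \<open>\<bar>y\<bar> \<le> e\<close> makes the positive part vanish; more than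
    \<open>2 / \<epsilon>\<close> steps of size \<epsilon> carry it past 1.\<close>
  obtain n where "2 / \<epsilon> < real n" using reals_Archimedean2 by blast
  then have n: "1 < - 1 + real n * \<epsilon>"
    using *(1) by (simp add: divide_less_eq)
  have "(- 1) *\<^sub>R e - y \<le> 0"
    using e by (simp add: abs_le_iff minus_le_iff)
  then have "pprt ((- 1) *\<^sub>R e - y) = 0" by (rule pprt_eq_0)
  then have "inf b0 (pprt ((- 1) *\<^sub>R e - y)) = 0" using *(4) by (simp add: inf.absorb2)
  from concentrate[OF e0 e *(1-6) this n]
  obtain b c where b: "0 \<le> b" "b \<le> b0" "inf t (\<Phi> x0 b) \<noteq> 0"
      "inf b (pprt (\<bar>y - c *\<^sub>R e\<bar> - \<epsilon> *\<^sub>R e)) = 0" by blast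
  let ?r = "\<Phi> \<bar>x\<bar> (pprt (\<bar>y - c *\<^sub>R e\<bar> - \<epsilon> *\<^sub>R e))"
  have "near_on (\<Phi> x y) e \<bar>x\<bar> \<epsilon> b (c *\<^sub>R x)"
    unfolding near_on_def
  proof (intro exI[of _ ?r] conjI allI impI)
    show "0 \<le> ?r" by (intro nonneg) simp_all
    have "\<Phi> x y - \<Phi> (c *\<^sub>R x) e = \<Phi> x (y - c *\<^sub>R e)"
      by (simp add: diff_right scaleR_left scaleR_right)
    then have "\<bar>\<Phi> x y - \<Phi> (c *\<^sub>R x) e\<bar> \<le> \<Phi> \<bar>x\<bar> \<bar>y - c *\<^sub>R e\<bar>"
      using abs_le by simp
    also have "\<bar>y - c *\<^sub>R e\<bar> = \<epsilon> *\<^sub>R e + (\<bar>y - c *\<^sub>R e\<bar> - \<epsilon> *\<^sub>R e)"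
      by simp
    also have "\<Phi> \<bar>x\<bar> \<dots> \<le> \<Phi> \<bar>x\<bar> (\<epsilon> *\<^sub>R e + pprt (\<bar>y - c *\<^sub>R e\<bar> - \<epsilon> *\<^sub>R e))"
      by (intro mono add_left_mono) (simp_all add: pprt_def)
    also have "\<dots> = \<epsilon> *\<^sub>R \<Phi> \<bar>x\<bar> e + ?r"
      by (simp add: add_right scaleR_right)
    finally show "\<bar>\<Phi> x y - \<Phi> (c *\<^sub>R x) e\<bar> \<le> \<epsilon> *\<^sub>R \<Phi> \<bar>x\<bar> e + ?r" .
    show "inf ?r (\<Phi> x' b) = 0" if "0 \<le> x'" for x'
      using that b by - (rule disjoint_right, simp_all add: inf.commute)
  qed
  with b show "\<exists>b\<ge>0. \<exists>z. b \<le> b0 \<and> inf t (\<Phi> x0 b) \<noteq> 0 \<and> near_on (\<Phi> x y) e \<bar>x\<bar> \<epsilon> b z"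
    by blast
qed

text \<open>The threshold makes \<open>e\<close> dominate the second factors, as
  \<open>localizable_simple\<close> demands; combining two elements takes the supremum of their
  thresholds. Nonnegative thresholds allow \<open>inf_left\<close> and
  \<open>sup_left\<close>.\<close>

lemma eventually_localizable: "\<exists>e0\<ge>0. \<forall>e\<ge>e0. localizable w e"
proof -
  let ?P = "\<lambda>w. \<exists>e0\<ge>0. \<forall>e\<ge>e0. localizable w e"
  have comb: "?P c" if P: "?P a" "?P b"
    and ex: "\<And>e z z'. 0 \<le> e \<Longrightarrow> \<exists>z''. \<bar>c - \<Phi> z'' e\<bar> \<le> \<bar>a - \<Phi> z e\<bar> + \<bar>b - \<Phi> z' e\<bar>" for a b c
  proof -
    from P obtain e1 e2 where *: "0 \<le> e1" "\<And>e. e1 \<le> e \<Longrightarrow> localizable a e"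
      "\<And>e. e2 \<le> e \<Longrightarrow> localizable b e" by blast
    have "localizable c e" if e: "sup e1 e2 \<le> e" for e
    proof (rule localizable_combine)
      show "localizable a e" "localizable b e"
        using e * by simp_all
      have "0 \<le> e" using *(1) e by (meson le_supE order_trans)
      then show "\<exists>z''. \<bar>c - \<Phi> z'' e\<bar> \<le> \<bar>a - \<Phi> z e\<bar> + \<bar>b - \<Phi> z' e\<bar>" for z z'
        by (rule ex)
    qed
    moreover have "0 \<le> sup e1 e2" using *(1) by (rule le_supI1)
    ultimately show ?thesis by blast
  qed
  show ?thesis
  proof (rule hull_induct[of w vector_sublattice "{\<Phi> x y | x y. True}"])
    show "w \<in> vector_sublattice hull {\<Phi> x y | x y. True}"
      unfolding generates by simp
    show simple: "?P x" if "x \<in> {\<Phi> x y | x y. True}" for x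
      using that localizable_simple abs_ge_zero by blast
    show "vector_sublattice {w. ?P w}"
      unfolding vector_sublattice_def
    proof (intro conjI subspaceI ballI; unfold mem_Collect_eq)
      have "\<Phi> 0 0 \<in> {\<Phi> x y | x y. True}" by blast
      from simple[OF this] show "?P 0" by simp
      show "?P (a + b)" if "?P a" "?P b" for a b
        using that
      proof (rule comb)
        show "\<exists>z''. \<bar>a + b - \<Phi> z'' e\<bar> \<le> \<bar>a - \<Phi> z e\<bar> + \<bar>b - \<Phi> z' e\<bar>" for e z z'
          using abs_triangle_ineq[of "a - \<Phi> z e" "b - \<Phi> z' e"]
          by (intro exI[of _ "z + z'"]) (simp add: add_left add_diff_add)
      qed
      show "?P (c *\<^sub>R a)" if "?P a" for a c
        using that localizable_scaleR by blast
      show "?P (inf a b)" if "?P a" "?P b" for a b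
        using that
      proof (rule comb)
        show "\<exists>z''. \<bar>inf a b - \<Phi> z'' e\<bar> \<le> \<bar>a - \<Phi> z e\<bar> + \<bar>b - \<Phi> z' e\<bar>" if "0 \<le> e" for e z z'
          using abs_inf_diff_le[of a b "\<Phi> z e" "\<Phi> z' e"] inf_left[OF that, of z z'] by metis
      qed
      show "?P (sup a b)" if "?P a" "?P b" for a b
        using that
      proof (rule comb)
        show "\<exists>z''. \<bar>sup a b - \<Phi> z'' e\<bar> \<le> \<bar>a - \<Phi> z e\<bar> + \<bar>b - \<Phi> z' e\<bar>" if "0 \<le> e" for e z z'
          using abs_sup_diff_le[of a b "\<Phi> z e" "\<Phi> z' e"] sup_left[OF that, of z z'] by metis
      qed
    qed
  qed
qed

section \<open>Infima of products with one factor fixed\<close>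

lemma le_zero_of_le_products:
  assumes e: "0 \<le> e" and P: "P \<noteq> {}" "\<And>p. p \<in> P \<Longrightarrow> 0 \<le> p" "\<And>z. (\<And>p. p \<in> P \<Longrightarrow> z \<le> p) \<Longrightarrow> z \<le> 0"
    and w: "\<And>p. p \<in> P \<Longrightarrow> w \<le> \<Phi> p e"
  shows "w \<le> 0"
proof -
  from eventually_localizable[of w] obtain e1 where "0 \<le> e1" and e1: "\<forall>e\<ge>e1. localizable w e"
    by (elim exE conjE)
  define d where "d = sup e e1"
  have ed: "e \<le> d" and e1d: "e1 \<le> d" by (simp_all add: d_def)
  have d: "0 \<le> d" using e ed by (rule order_trans)
  have w': "w \<le> \<Phi> p d" if "p \<in> P" for p
    using w[OF that] mono[OF P(2)[OF that] e order.refl ed] by (rule order_trans)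
  have "localizable w d" using e1 e1d by simp
  then obtain u where u: "0 \<le> u" "\<forall>\<epsilon>>0. \<forall>t\<ge>0. \<forall>x0\<ge>0. \<forall>b0\<ge>0. b0 \<le> d \<longrightarrow> inf t (\<Phi> x0 b0) \<noteq> 0 \<longrightarrow>
      (\<exists>b\<ge>0. \<exists>z. b \<le> b0 \<and> inf t (\<Phi> x0 b) \<noteq> 0 \<and> near_on w d u \<epsilon> b z)"
    unfolding localizable_def by (elim exE conjE)
  \<comment> \<open>One \<open>\<epsilon> *\<^sub>R \<Phi> u d\<close> pays for replacing
    \<open>w\<close> by \<open>\<Phi> z d\<close>, the other for the bound on
    \<open>z\<close>.\<close>
  have "w \<le> \<epsilon> *\<^sub>R (2 *\<^sub>R \<Phi> u d)" if \<epsilon>: "0 < \<epsilon>" for \<epsilon>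
  proof (rule ccontr)
    assume nle: "\<not> w \<le> \<epsilon> *\<^sub>R (2 *\<^sub>R \<Phi> u d)"
    define t where "t = pprt (w - \<epsilon> *\<^sub>R (2 *\<^sub>R \<Phi> u d))"
    have t0: "0 \<le> t" by (simp add: t_def)
    have "t \<noteq> 0" using nle unfolding t_def le_zero_iff_zero_pprt[symmetric] by simp
    \<comment> \<open>Any \<open>x0\<close> in \<open>P\<close> gives
      \<open>t \<le> \<Phi> x0 d\<close>, so \<open>t\<close> meets this product and the
      localization can start from \<open>d\<close> itself.\<close>
    obtain x0 where x0: "x0 \<in> P" using P(1) by blast
    have "0 \<le> \<epsilon> *\<^sub>R (2 *\<^sub>R \<Phi> u d)"
      using \<epsilon> u(1) d by (intro scaleR_nonneg_nonneg nonneg) simp_all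
    then have "w - \<epsilon> *\<^sub>R (2 *\<^sub>R \<Phi> u d) \<le> w"
      by simp
    then have "t \<le> \<Phi> x0 d"
      unfolding t_def pprt_def
      by (rule sup_least[OF order_trans[OF _ w'[OF x0]] nonneg[OF P(2)[OF x0] d]])
    then have "inf t (\<Phi> x0 d) \<noteq> 0" using \<open>t \<noteq> 0\<close> by (simp add: inf.absorb1)
    from u(2)[rule_format, OF \<epsilon> t0 P(2)[OF x0] d order.refl this]
    obtain b z where b: "0 \<le> b" "b \<le> d" "inf t (\<Phi> x0 b) \<noteq> 0" "near_on w d u \<epsilon> b z"
      by blast
    have "b \<noteq> 0" using b(3) t0 by (auto simp: inf_absorb2)
    obtain r where r: "0 \<le> r" "\<bar>w - \<Phi> z d\<bar> \<le> \<epsilon> *\<^sub>R \<Phi> u d + r"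
        "\<forall>x\<ge>0. inf r (\<Phi> x b) = 0"
      using b(4) unfolding near_on_def by (elim exE conjE)
    have "z - \<epsilon> *\<^sub>R u \<le> p" if p: "p \<in> P" for p
    proof -
      \<comment> \<open>The positive part of \<open>?d\<close>, multiplied by \<open>b\<close>, lies
        below \<open>r\<close> and is disjoint from \<open>r\<close>, so the product is zero; as
        \<open>b \<noteq> 0\<close>, nondegeneracy removes the positive part.\<close>
      let ?d = "z - \<epsilon> *\<^sub>R u - p"
      have "\<Phi> z d - w \<le> \<epsilon> *\<^sub>R \<Phi> u d + r"
        using order_trans[OF abs_ge_minus_self r(2)] by (simp only: minus_diff_eq)
      from add_mono[OF this w'[OF p]] have "\<Phi> z d \<le> \<epsilon> *\<^sub>R \<Phi> u d + r + \<Phi> p d"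
        by simp
      then have "\<Phi> ?d d \<le> r"
        by (simp add: diff_left add_left scaleR_left algebra_simps)
      then have le: "\<Phi> (pprt ?d) d \<le> r"
        using r(1) unfolding pprt_left[OF d] by (simp add: pprt_def)
      have "\<Phi> (pprt ?d) b \<le> r"
        using mono[OF zero_le_pprt b(1) order.refl b(2)] le by (rule order_trans)
      moreover have "inf r (\<Phi> (pprt ?d) b) = 0" by (rule r(3)[rule_format]) simp
      ultimately have "\<Phi> (pprt ?d) b = 0" by (simp only: inf.absorb2)
      from eq_zero[OF this] \<open>b \<noteq> 0\<close> have "pprt ?d = 0" by simp
      then show ?thesis unfolding le_zero_iff_zero_pprt[symmetric] by simp
    qed
    then have "z - \<epsilon> *\<^sub>R u \<le> 0" by (rule P(3))
    then have "\<Phi> z d \<le> \<epsilon> *\<^sub>R \<Phi> u d"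
      using nonneg[OF _ d, of "\<epsilon> *\<^sub>R u - z"] by (simp add: diff_left scaleR_left)
    from add_mono[OF order_trans[OF abs_ge_self r(2)] this]
    have "w \<le> \<epsilon> *\<^sub>R \<Phi> u d + r + \<epsilon> *\<^sub>R \<Phi> u d"
      by simp
    then have "w - \<epsilon> *\<^sub>R (2 *\<^sub>R \<Phi> u d) \<le> r"
      by (simp add: scaleR_2 algebra_simps)
    \<comment> \<open>The excess \<open>t\<close> is now part of the remainder, which is disjoint
      from \<open>\<Phi> x0 b\<close>, although \<open>b\<close> was chosen so that this product
      meets \<open>t\<close>.\<close>
    then have "t \<le> r" unfolding t_def pprt_def using r(1) by (rule sup_least)
    from disjoint_mono[OF t0 nonneg[OF P(2)[OF x0] b(1)] this order.refl r(3)[rule_format, OF P(2)[OF x0]]]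
    have "inf t (\<Phi> x0 b) = 0" .
    with b(3) show False by contradiction
  qed
  moreover have "0 \<le> 2 *\<^sub>R \<Phi> u d"
    using u(1) d by (intro scaleR_nonneg_nonneg nonneg) simp_all
  ultimately show ?thesis by (rule archimedean_eps)
qed

subsection \<open>Unbounded order convergence of products\<close>

text \<open>Expanding around \<open>x0\<close> and \<open>y0\<close> leaves two linear terms and one
  quadratic term. By \<open>inf_le\<close> the quadratic term contributes the same two bounds once
  more, hence the factors 2.\<close>

lemma inf_abs_diff_le:
  assumes u: "\<bar>x0\<bar> \<le> u" and v: "\<bar>y0\<bar> \<le> v"
  shows "inf \<bar>\<Phi> x y - \<Phi> x0 y0\<bar> (\<Phi> u v) \<le>
    \<Phi> (inf \<bar>x - x0\<bar> u) (2 *\<^sub>R v) + \<Phi> (2 *\<^sub>R u) (inf \<bar>y - y0\<bar> v)"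
proof -
  let ?x = "\<bar>x - x0\<bar>" and ?y = "\<bar>y - y0\<bar>"
  have u0: "0 \<le> u" and v0: "0 \<le> v"
    using order_trans[OF abs_ge_zero u] order_trans[OF abs_ge_zero v] .
  have "\<Phi> x y - \<Phi> x0 y0 = \<Phi> (x - x0) (y - y0) + (\<Phi> x0 (y - y0) + \<Phi> (x - x0) y0)"
    by (simp add: diff_left diff_right)
  then have "\<bar>\<Phi> x y - \<Phi> x0 y0\<bar> \<le>
      \<bar>\<Phi> (x - x0) (y - y0)\<bar> + (\<bar>\<Phi> x0 (y - y0)\<bar> + \<bar>\<Phi> (x - x0) y0\<bar>)"
    by (simp only: order_trans[OF abs_triangle_ineq add_left_mono[OF abs_triangle_ineq]])
  also have "\<dots> \<le> \<Phi> ?x ?y + (\<Phi> u ?y + \<Phi> ?x v)"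
    by (intro add_mono order_trans[OF abs_le] mono abs_ge_zero order.refl u v)
  finally have "inf \<bar>\<Phi> x y - \<Phi> x0 y0\<bar> (\<Phi> u v) \<le>
      inf (\<Phi> ?x ?y) (\<Phi> u v) + inf (\<Phi> u ?y + \<Phi> ?x v) (\<Phi> u v)"
    by (rule inf_abs_add_le) (intro add_nonneg_nonneg nonneg abs_ge_zero u0 v0)+
  also have "inf (\<Phi> u ?y + \<Phi> ?x v) (\<Phi> u v) \<le> inf (\<Phi> u v) (\<Phi> u ?y) + inf (\<Phi> u v) (\<Phi> ?x v)"
    unfolding inf.commute[of _ "\<Phi> u v"]
    by (rule inf_add_le) (intro nonneg abs_ge_zero u0 v0)+
  also have "inf (\<Phi> u v) (\<Phi> u ?y) = \<Phi> u (inf ?y v)"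
    by (simp only: inf_right[OF u0] inf.commute)
  also have "inf (\<Phi> u v) (\<Phi> ?x v) = \<Phi> (inf ?x u) v"
    by (simp only: inf_left[OF v0] inf.commute)
  also have "inf (\<Phi> ?x ?y) (\<Phi> u v) \<le> \<Phi> (inf ?x u) v + \<Phi> u (inf ?y v)"
    by (intro inf_le abs_ge_zero u0 v0)
  finally show ?thesis
    by (simp add: add_left add_right scaleR_2 ac_simps)
qed

lemma uo_converges_bimorphism:
  assumes f: "uo_converges A leA f f0" and g: "uo_converges B leB g g0"
  shows "uo_converges (A \<times> B) (rel_prod leA leB) (\<lambda>(a, b). \<Phi> (f a) (g b)) (\<Phi> f0 g0)"
  unfolding uo_converges_def
proof (intro allI impI)
  fix w :: 't
  assume "0 \<le> w"
  obtain u1 v1 where uv1: "0 \<le> u1" "0 \<le> v1" "\<bar>w\<bar> \<le> \<Phi> u1 v1" by (rule abs_le_simple)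
  \<comment> \<open>The truncation levels must dominate the limits, for
    \<open>inf_abs_diff_le\<close>, and make \<open>\<Phi> u v\<close> exceed
    \<open>w\<close>.\<close>
  define u v where "u = u1 + \<bar>f0\<bar>" and "v = v1 + \<bar>g0\<bar>"
  have u: "0 \<le> u" "\<bar>f0\<bar> \<le> u" "u1 \<le> u" and v: "0 \<le> v" "\<bar>g0\<bar> \<le> v" "v1 \<le> v"
    using uv1 by (simp_all add: u_def v_def)
  have w: "w \<le> \<Phi> u v"
    by (rule order_trans[OF abs_ge_self order_trans[OF uv1(3) mono[OF uv1(1,2) u(3) v(3)]]])
  obtain C leC p where C: "directed_set C leC" "decreases_to_zero C leC (p :: 'e \<Rightarrow> 'e)"
    "\<forall>c\<in>C. \<exists>a0\<in>A. \<forall>a\<in>A. leA a0 a \<longrightarrow> \<bar>inf \<bar>f a - f0\<bar> u - 0\<bar> \<le> p c"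
    using f[unfolded uo_converges_def, rule_format, OF u(1)] unfolding order_converges_def
    by (elim exE conjE)
  obtain D leD q where D: "directed_set D leD" "decreases_to_zero D leD (q :: 'f \<Rightarrow> 'f)"
    "\<forall>d\<in>D. \<exists>b0\<in>B. \<forall>b\<in>B. leB b0 b \<longrightarrow> \<bar>inf \<bar>g b - g0\<bar> v - 0\<bar> \<le> q d"
    using g[unfolded uo_converges_def, rule_format, OF v(1)] unfolding order_converges_def
    by (elim exE conjE)
  have p0: "\<And>c. c \<in> C \<Longrightarrow> 0 \<le> p c" and q0: "\<And>d. d \<in> D \<Longrightarrow> 0 \<le> q d"
    using C(2) D(2) unfolding decreases_to_zero_def by simp_all
  have e: "0 \<le> 2 *\<^sub>R u" "0 \<le> 2 *\<^sub>R v"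
    using u(1) v(1) by (simp_all add: scaleR_nonneg_nonneg)
  let ?s = "\<lambda>c d. \<Phi> (p c) (2 *\<^sub>R v) + \<Phi> (2 *\<^sub>R u) (q d)"
  have s_mono: "?s c' d' \<le> ?s c d"
    if "c' \<in> C" "d' \<in> D" "p c' \<le> p c" "q d' \<le> q d" for c c' d d'
    using that by (intro add_mono mono p0 q0 e order.refl)
  let ?S = "{?s c d | c d. c \<in> C \<and> d \<in> D}"
  show "order_converges (A \<times> B) (rel_prod leA leB)
      (\<lambda>ab. inf \<bar>(case ab of (a, b) \<Rightarrow> \<Phi> (f a) (g b)) - \<Phi> f0 g0\<bar> w) 0"
  proof (rule order_convergesI[where S = ?S])
    show "?S \<noteq> {}"
      using C(1) D(1) unfolding directed_set_def by blast
  next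
    fix s t
    assume "s \<in> ?S" "t \<in> ?S"
    then obtain c d c' d' where s: "s = ?s c d" "c \<in> C" "d \<in> D" and t: "t = ?s c' d'" "c' \<in> C" "d' \<in> D"
      by blast
    obtain c'' where c'': "c'' \<in> C" "leC c c''" "leC c' c''"
      using C(1) s(2) t(2) unfolding directed_set_def by blast
    obtain d'' where d'': "d'' \<in> D" "leD d d''" "leD d' d''"
      using D(1) s(3) t(3) unfolding directed_set_def by blast
    have "p c'' \<le> p c" "p c'' \<le> p c'" "q d'' \<le> q d" "q d'' \<le> q d'"
      using C(2) D(2) s t c'' d'' unfolding decreases_to_zero_def by simp_all
    then have "?s c'' d'' \<le> s" "?s c'' d'' \<le> t"
      unfolding s t using c''(1) d''(1) by (simp_all only: s_mono)
    with c''(1) d''(1) show "\<exists>r\<in>?S. r \<le> s \<and> r \<le> t"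
      by blast
  next
    fix s
    assume "s \<in> ?S"
    then show "0 \<le> s"
      using p0 q0 e by (auto intro!: add_nonneg_nonneg nonneg)
  next
    fix z
    assume z: "\<And>s. s \<in> ?S \<Longrightarrow> z \<le> s"
    \<comment> \<open>The infimum is taken one index at a time: for fixed \<open>d\<close>, varying
      \<open>c\<close> removes the first summand of \<open>?s\<close>; then \<open>d\<close> varies,
      with the variables of \<open>\<Phi>\<close> exchanged.\<close>
    show "z \<le> 0"
    proof (rule nondegenerate_bimorphism.le_zero_of_le_products[OF flip e(1), of "q ` D"])
      show "q ` D \<noteq> {}" using D(1) unfolding directed_set_def by simp
      show "z' \<le> 0" if "\<And>r. r \<in> q ` D \<Longrightarrow> z' \<le> r" for z'
        using D(2) that unfolding decreases_to_zero_def by simp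
      show "0 \<le> r" if "r \<in> q ` D" for r
        using that q0 by blast
    next
      fix r
      assume "r \<in> q ` D"
      then obtain d where d: "d \<in> D" "r = q d" by blast
      have "z - \<Phi> (2 *\<^sub>R u) r \<le> 0"
      proof (rule le_zero_of_le_products[OF e(2), of "p ` C"])
        show "p ` C \<noteq> {}" using C(1) unfolding directed_set_def by simp
        show "z' \<le> 0" if "\<And>r. r \<in> p ` C \<Longrightarrow> z' \<le> r" for z'
          using C(2) that unfolding decreases_to_zero_def by simp
        show "0 \<le> r" if "r \<in> p ` C" for r
          using that p0 by blast
        show "z - \<Phi> (2 *\<^sub>R u) r \<le> \<Phi> r' (2 *\<^sub>R v)" if "r' \<in> p ` C" for r'
          using that z d unfolding diff_le_eq by blast
      qed
      then show "z \<le> \<Phi> (2 *\<^sub>R u) r" by simp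
    qed
  next
    fix s
    assume "s \<in> ?S"
    then obtain c d where s: "s = ?s c d" and c: "c \<in> C" and d: "d \<in> D" by blast
    obtain a0 where a0: "a0 \<in> A" "\<forall>a\<in>A. leA a0 a \<longrightarrow> \<bar>inf \<bar>f a - f0\<bar> u - 0\<bar> \<le> p c"
      using C(3) c by blast
    obtain b0 where b0: "b0 \<in> B" "\<forall>b\<in>B. leB b0 b \<longrightarrow> \<bar>inf \<bar>g b - g0\<bar> v - 0\<bar> \<le> q d"
      using D(3) d by blast
    have "\<bar>inf \<bar>\<Phi> (f a) (g b) - \<Phi> f0 g0\<bar> w - 0\<bar> \<le> s"
      if "a \<in> A" "b \<in> B" "leA a0 a" "leB b0 b" for a b
    proof -
      have fa: "inf \<bar>f a - f0\<bar> u \<le> p c" and gb: "inf \<bar>g b - g0\<bar> v \<le> q d"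
        using a0(2) b0(2) that abs_ge_self order_trans by (simp add: abs_le_iff)+
      have "\<bar>inf \<bar>\<Phi> (f a) (g b) - \<Phi> f0 g0\<bar> w - 0\<bar> = inf \<bar>\<Phi> (f a) (g b) - \<Phi> f0 g0\<bar> w"
        using \<open>0 \<le> w\<close> by simp
      also have "\<dots> \<le> inf \<bar>\<Phi> (f a) (g b) - \<Phi> f0 g0\<bar> (\<Phi> u v)"
        using w by (intro inf_mono order.refl)
      also have "\<dots> \<le> \<Phi> (inf \<bar>f a - f0\<bar> u) (2 *\<^sub>R v) + \<Phi> (2 *\<^sub>R u) (inf \<bar>g b - g0\<bar> v)"
        by (rule inf_abs_diff_le[OF u(2) v(2)])
      also have "\<dots> \<le> s"
        unfolding s using u(1) v(1) by (intro add_mono mono fa gb e order.refl) simp_all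
      finally show ?thesis .
    qed
    then show "\<exists>ab0\<in>A \<times> B. \<forall>ab\<in>A \<times> B. rel_prod leA leB ab0 ab \<longrightarrow>
        \<bar>inf \<bar>(case ab of (a, b) \<Rightarrow> \<Phi> (f a) (g b)) - \<Phi> f0 g0\<bar> w - 0\<bar> \<le> s"
      using a0(1) b0(1) by (intro bexI[of _ "(a0, b0)"] ballI impI) (auto simp only: mem_Times_iff
        rel_prod_inject fst_conv snd_conv split: prod.splits)
  qed
qed

end

subsection \<open>The algebraic and the Fremlin tensor product\<close>

lemma exists_linear_functional_ne_zero:
  fixes x :: "'a::real_vector"
  assumes "x \<noteq> 0"
  obtains h :: "'a \<Rightarrow> real" where "linear h" "h x \<noteq> 0"
proof -
  have "independent {x}" using assms by simp
  from linear_independent_extend[OF this, of "\<lambda>_. 1"]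
  show ?thesis using that by force
qed

text \<open>Functionals not vanishing at \<open>x\<close> and \<open>y\<close> induce a linear form
  on the free vector space that kills the bilinearity relations but takes the nonzero value
  \<open>h x * k y\<close> at \<open>pair_gen x y\<close>.\<close>

lemma tensor_eq_zeroD:
  fixes x :: "'e::real_vector" and y :: "'f::real_vector"
  assumes "tensor x y = 0"
  shows "x = 0 \<or> y = 0"
proof (rule ccontr)
  assume "\<not> (x = 0 \<or> y = 0)"
  then obtain h k where h: "linear h" "h x \<noteq> (0::real)" and k: "linear k" "k y \<noteq> (0::real)"
    using exists_linear_functional_ne_zero by metis
  let ?m = "\<lambda>q. h (fst q) * k (snd q)"
  define L where "L p = (\<Sum>q\<in>Poly_Mapping.keys p. Poly_Mapping.lookup p q * ?m q)"
    for p :: "('e \<times> 'f) \<Rightarrow>\<^sub>0 real"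
  \<comment> \<open>Enlarging the range of summation lets the sums for different \<open>p\<close>
    run over a common finite set.\<close>
  have L: "L p = (\<Sum>q\<in>K. Poly_Mapping.lookup p q * ?m q)"
    if "finite K" "Poly_Mapping.keys p \<subseteq> K" for p K
    unfolding L_def using that by (intro sum.mono_neutral_left) (auto simp: in_keys_iff)
  have add: "L (p + q) = L p + L q" for p q
  proof -
    let ?K = "Poly_Mapping.keys p \<union> Poly_Mapping.keys q"
    show ?thesis
      using L[of ?K p] L[of ?K q] L[of ?K "p + q"] keys_add[of p q]
      by (simp add: lookup_add sum.distrib distrib_right)
  qed
  have scale: "L (c *\<^sub>R p) = c *\<^sub>R L p" for c p
    using L[of "Poly_Mapping.keys p" "c *\<^sub>R p"] L[of "Poly_Mapping.keys p" p]
    by (simp add: scaleR_poly_mapping.rep_eq sum_distrib_left mult.assoc subset_iff in_keys_iff)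
  have lin: "linear L" by (rule linearI) (fact add scale)+
  have L_gen: "L (pair_gen a b) = h a * k b" for a b
    by (simp add: L_def pair_gen_def)
  have "L p = 0" if "p \<in> span bilinearity_relations" for p
  proof (rule linear_eq_0_on_span[OF lin _ that])
    fix p :: "('e \<times> 'f) \<Rightarrow>\<^sub>0 real"
    assume "p \<in> bilinearity_relations"
    then show "L p = 0"
      unfolding bilinearity_relations_def
      by (elim UnE CollectE exE conjE; hypsubst)
        (simp_all add: linear_diff[OF lin] linear_add[OF lin] linear_scale[OF lin] L_gen linear_add[OF h(1)]
          linear_add[OF k(1)] linear_scale[OF h(1)] linear_scale[OF k(1)] algebra_simps)
  qed
  moreover have "pair_gen x y \<in> span bilinearity_relations"
    using assms by transfer (simp add: tensor_eq_def)
  ultimately show False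
    using h(2) k(2) L_gen[of x y] by simp
qed

lemma update_eq_add_single:
  assumes "a \<notin> Poly_Mapping.keys f"
  shows "Poly_Mapping.update a b f = f + Poly_Mapping.single a b"
  using assms by (intro poly_mapping_eqI) (auto simp: lookup_update lookup_add lookup_single in_keys_iff when_def)

text \<open>Induction on formal sums: each step adds a multiple of one generator, whose class is an
  elementary tensor.\<close>

lemma subspace_tensors_eq_UNIV:
  fixes S :: "('e::real_vector, 'f::real_vector) alg_tensor set"
  assumes "subspace S" "\<And>x y. tensor x y \<in> S"
  shows "S = UNIV"
proof -
  have "abs_alg_tensor p \<in> S" for p :: "('e \<times> 'f) \<Rightarrow>\<^sub>0 real"
  proof (induction p rule: update_induct)
    case const
    then show ?case
      using subspace_0[OF assms(1)] by (simp add: zero_alg_tensor_def)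
  next
    case (update f q b)
    obtain x y where q: "q = (x, y)" by (cases q)
    have "Poly_Mapping.update q b f = f + b *\<^sub>R pair_gen x y"
      using update_eq_add_single[OF update(1), of b]
      by (intro poly_mapping_eqI) (simp add: q pair_gen_def lookup_add lookup_single
          scaleR_poly_mapping.rep_eq when_def)
    then have "abs_alg_tensor (Poly_Mapping.update q b f) = abs_alg_tensor f + b *\<^sub>R tensor x y"
      by (simp add: plus_alg_tensor.abs_eq scaleR_alg_tensor.abs_eq tensor.abs_eq)
    then show ?case
      using update assms by (simp add: subspace_add subspace_scale)
  qed
  then show ?thesis
    by (metis UNIV_eq_I Quotient_abs_rep[OF Quotient_alg_tensor])
qed

lemma vector_sublattice_hull: "vector_sublattice (vector_sublattice hull S)"
  by (rule hull_in) (auto simp: vector_sublattice_def intro: subspace_Inter)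

lemma fremlin_tensor_product_nondegenerate_bimorphism:
  assumes "fremlin_tensor_product \<iota>"
  shows "nondegenerate_bimorphism (\<lambda>x y. \<iota> (tensor x y))"
proof
  have lin: "linear \<iota>" and inj: "inj \<iota>" and hull: "vector_sublattice hull (range \<iota>) = UNIV"
    and bim: "lattice_bimorphism_into type_space (\<lambda>x y. \<iota> (tensor x y))"
    using assms unfolding fremlin_tensor_product_def by simp_all
  show "\<iota> (tensor (x + x') y) = \<iota> (tensor x y) + \<iota> (tensor x' y)" for x x' y
    by (simp add: bilinear_tensor linear_add[OF lin])
  show "\<iota> (tensor x (y + y')) = \<iota> (tensor x y) + \<iota> (tensor x y')" for x y y'
    by (simp add: bilinear_tensor linear_add[OF lin])
  show "\<iota> (tensor (c *\<^sub>R x) y) = c *\<^sub>R \<iota> (tensor x y)" for c x y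
    by (simp add: bilinear_tensor linear_scale[OF lin])
  show "\<iota> (tensor x (c *\<^sub>R y)) = c *\<^sub>R \<iota> (tensor x y)" for c x y
    by (simp add: bilinear_tensor linear_scale[OF lin])
  show "\<iota> (tensor (inf x x') y) = inf (\<iota> (tensor x y)) (\<iota> (tensor x' y))" if "0 \<le> y" for x x' y
    using bim that by (simp add: lattice_bimorphism_into_def lattice_hom_into_def)
  show "\<iota> (tensor x (inf y y')) = inf (\<iota> (tensor x y)) (\<iota> (tensor x y'))" if "0 \<le> x" for x y y'
    using bim that by (simp add: lattice_bimorphism_into_def lattice_hom_into_def)
  show "x = 0 \<or> y = 0" if "\<iota> (tensor x y) = 0" for x y
  proof -
    have "\<iota> (tensor x y) = \<iota> 0" using that linear_0[OF lin] by simp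
    then show ?thesis using injD[OF inj] tensor_eq_zeroD by blast
  qed
  \<comment> \<open>The preimage of \<open>?H\<close> under \<iota> is a subspace containing all
    elementary tensors, hence everything. So \<open>?H\<close> contains the range of \<iota> and the
    sublattice it generates.\<close>
  let ?H = "vector_sublattice hull {\<iota> (tensor x y) | x y. True}"
  have H: "vector_sublattice ?H" by (rule vector_sublattice_hull)
  have "subspace {t. \<iota> t \<in> ?H}"
    using H linear_subspace_vimage[OF lin, of ?H] by (simp add: vector_sublattice_def vimage_def)
  moreover have "tensor x y \<in> {t. \<iota> t \<in> ?H}" for x y
    by (auto intro: hull_inc)
  ultimately have "{t. \<iota> t \<in> ?H} = UNIV"
    by (rule subspace_tensors_eq_UNIV)
  then have "range \<iota> \<subseteq> ?H" by auto
  then show "?H = UNIV"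
    using hull_minimal[of "range \<iota>" ?H vector_sublattice] H hull by blast
qed

theorem theorem7:
  fixes f :: "'i \<Rightarrow> 'e::archimedean_vector_lattice" and f0 :: 'e
    and g :: "'j \<Rightarrow> 'f::archimedean_vector_lattice" and g0 :: 'f
    and A :: "'i set" and leA :: "'i \<Rightarrow> 'i \<Rightarrow> bool"
    and B :: "'j set" and leB :: "'j \<Rightarrow> 'j \<Rightarrow> bool"
    and \<iota> :: "('e, 'f) alg_tensor \<Rightarrow> 't::archimedean_vector_lattice"
  assumes "fremlin_tensor_product \<iota>"
    and "directed_set A leA" and "directed_set B leB"
    and "uo_converges A leA f f0"
    and "uo_converges B leB g g0"
  shows "uo_converges (A \<times> B) (rel_prod leA leB)
           (\<lambda>(a, b). \<iota> (tensor (f a) (g b))) (\<iota> (tensor f0 g0))"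
  using nondegenerate_bimorphism.uo_converges_bimorphism
    [OF fremlin_tensor_product_nondegenerate_bimorphism[OF assms(1)] assms(4,5)] .

end
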